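(* Consider DGM-BB-C (defined in the context) for minimizing $f=\frac1n\sum_{i=1}^n f_i$ on $\mathbb{R}^p$, where each $f_i$ is differentiable with $L$-Lipschitz gradient and $\mu$-strongly convex, the graph $\mathcal G$ is connected, and the weight matrix $W$ is doubly stochastic with $\delta=\|W-\frac1n\mathbf 1\mathbf 1^T\|_2<1$. Suppose that $$\frac1n\sum_{i=1}^n\alpha_k^i\le \frac{2}{L}-\frac{\mu}{L^2}\quad\text{for all }k,$$ and that the largest step size satisfies $\frac1L\le\alpha_{\max}\le\frac1\mu$. Let $c_1,c_2>0$ be any positive scalars, let $c_3>\frac{L(Lc_1+c_2)}{\mu^2\sqrt n}$, put $C=Lc_1+c_2+L\sqrt n\,c_3$ and $$\Delta=\min\left\{\frac{\mu c_1}{C+\mu c_1},\ \frac{\mu c_2}{LC+2L\mu c_1+\mu c_2}\right\},$$ and suppose the number of inner consensus iterations $R$ satisfies $$R\ \ge\ \left\lceil\frac{\ln\Delta}{\ln\delta}\right\rceil+\varphi\!\left(\frac{\ln\Delta}{\ln\delta}\right),$$ where $\varphi(x)=1$ if $x$ is a positive integer and $\varphi(x)=0$ otherwise. Then the sequence $\{\mathbf x_k\}$ generated by DGM-BB-C converges to the unique optimizer $\mathbf x^*=\mathbf 1(x^* )^T$ at a geometric rate: for every arbitrarily small constant $\xi>0$ there exists a constant $M>0$ such that, for all $k$, $$\|\mathbf x_k-\mathbf x^*\|\le M\,(\rho(G^\alpha)+\xi)^k ,$$ where $$G^{\alpha}=\begin{pmatrix}\delta^R+\delta^RL\alpha_{\max}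 & \delta^R\alpha_{\max} & \delta^RL\sqrt n\,\alpha_{\max}\\ 2\delta^RL+\delta^RL^2\alpha_{\max} & \delta^R+\delta^RL\alpha_{\max} & \delta^RL^2\sqrt n\,\alpha_{\max}\\ \frac{L}{\sqrt n}\alpha_{\max} & \frac{1}{\sqrt n}\alpha_{\max} & 1-\frac{\mu}{L}\end{pmatrix}.$$
   Context: Problem: $n$ agents communicate over a time-invariant connected undirected graph $\mathcal G=(\mathcal V,\mathcal E)$, $\mathcal V=\{1,\dots,n\}$, with $\mathcal N_i=\{j\ne i:(i,j)\in\mathcal E\}$. They solve $\min_{x\in\mathbb R^p} f(x)=\frac1n\sum_{i=1}^n f_i(x)$, with $f_i:\mathbb R^p\to\mathbb R$ convex and differentiable. Assumption 1 (smoothness): there is $L>0$ with $\|\nabla f_i(x)-\nabla f_i(y)\|\le L\|x-y\|$ for all $x,y\in\mathbb R^p$ and all $i$. Assumption 2 (strong convexity): there is $\mu>0$ with $f_i(x)\ge f_i(y)+\nabla f_i(y)^T(x-y)+\frac\mu2\|x-y\|^2$ for all $x,y\in\mathbb R^p$ and all $i$. Hence $\mu\le L$ and the problem has a unique solution $x^*\in\mathbb R^p$. Assumption 3: $\mathcal G$ is connected and $W=[w_{ij}]\in\mathbb R^{n\times n}$ is doubly stochastic (with $w_{ij}=0$ unless $j\in\mathcal N_i\cup\{i\}$). $\delta$ is the spectral norm of $W-\frac1n\mathbf 1\mathbf 1^T$, and $\delta<1$; $\delta>0$ is understood wherever $\ln\delta$ appears. Notation: $\mathbf 1\in\mathbb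 R^n$ is the all-ones column vector. $\|\cdot\|$ is the Euclidean norm for vectors and the Frobenius norm for matrices; $\rho(\cdot)$ is the spectral radius. $\mathbf x_k=[x_k^1,\dots,x_k^n]^T$ and $\mathbf y_k=[y_k^1,\dots,y_k^n]^T$ are in $\mathbb R^{n\times p}$; $\nabla\mathbf f(\mathbf x)=[\nabla f_1(x^1),\dots,\nabla f_n(x^n)]^T\in\mathbb R^{n\times p}$. DGM-BB-C with a fixed positive integer $R$ (number of inner consensus iterations): $x_0^i\in\mathbb R^p$ arbitrary, $y_0^i=\nabla f_i(x_0^i)$, $\alpha_0^i>0$, and for $k\ge0$ $$\mathbf x_{k+1}=W^R[\mathbf x_k-D_k\mathbf y_k],\qquad \mathbf y_{k+1}=W^R[\mathbf y_k+\nabla\mathbf f(\mathbf x_{k+1})-\nabla\mathbf f(\mathbf x_k)],$$ where $D_k=\mathrm{diag}(\alpha_k^1,\dots,\alpha_k^n)$ and, for $k\ge1$, $\alpha_k^i$ is the distributed Barzilai-Borwein step size, computed by either $$\alpha_k^i=\frac{(s_k^i)^Ts_k^i}{(s_k^i)^Tz_k^i}\quad\text{or}\quad \alpha_k^i=\frac{(s_k^i)^Tz_k^i}{(z_k^i)^Tz_k^i},\qquad s_k^i=x_k^i-x_{k-1}^i,\ z_k^i=\nabla f_i(x_k^i)-\nabla f_i(x_{k-1}^i)$$ (the denominators being assumed nonzero, i.e. $s_k^i\ne0$). The largest step size is $\alpha_{\max}=\max_{k\ge0,\,1\le i\le n}\alpha_k^i$ (read as a supremum). *)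

theory Defs
  imports "HOL-Analysis.Analysis" "Jordan_Normal_Form.Spectral_Radius"
begin

(* Both libraries use the infix dollar sign for vector components; it is kept for vec_nth. *)
no_notation vec_index (infixl "$" 100)

text \<open>
  The agents are the elements of a finite type \<open>'n\<close>. An \<open>n \<times> p\<close> matrix whose rows are
  the agents' vectors has type \<open>real^'p^'n\<close>, so \<open>x $ i\<close> is the vector held by agent \<open>i\<close>
  and the norm of this type is the Frobenius norm. The step sizes are \<open>\<alpha> k i\<close>.
\<close>

definition connected_graph :: "('n \<times> 'n) set \<Rightarrow> bool" where
  "connected_graph E \<longleftrightarrow> sym E \<and> (\<forall>i j. (i, j) \<in> E\<^sup>*)"

definition neighbours :: "('n \<times> 'n) set \<Rightarrow> 'n \<Rightarrow> 'n set" where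
  "neighbours E i = {j. j \<noteq> i \<and> (i, j) \<in> E}"

definition doubly_stochastic :: "real^'n^'n \<Rightarrow> bool" where
  "doubly_stochastic W \<longleftrightarrow>
     (\<forall>i j. 0 \<le> W $ i $ j) \<and> (\<forall>i. (\<Sum>j\<in>UNIV. W $ i $ j) = 1) \<and> (\<forall>j. (\<Sum>i\<in>UNIV. W $ i $ j) = 1)"

text \<open>The matrix \<open>(1/n) 1 1\<^sup>T\<close>.\<close>

definition averaging_matrix :: "real^'n^'n" where
  "averaging_matrix = (\<chi> i j. 1 / real CARD('n))"

definition spectral_norm :: "real^'n^'m \<Rightarrow> real" where
  "spectral_norm A = onorm (\<lambda>v. A *v v)"

text \<open>
  The powers of the class \<open>monoid_mult\<close> on \<open>real^'n^'n\<close> are taken entrywise,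
  so powers with respect to the matrix product need a definition of their own.
\<close>

primrec matrix_power :: "real^'n^'n \<Rightarrow> nat \<Rightarrow> real^'n^'n" where
  "matrix_power A 0 = Finite_Cartesian_Product.mat 1"
| "matrix_power A (Suc k) = A ** matrix_power A k"

definition diag_matrix :: "('n \<Rightarrow> real) \<Rightarrow> real^'n^'n" where
  "diag_matrix a = (\<chi> i j. if i = j then a i else 0)"

definition avg_objective :: "('n::finite \<Rightarrow> real^'p \<Rightarrow> real) \<Rightarrow> real^'p \<Rightarrow> real" where
  "avg_objective f x = (1 / real CARD('n)) * (\<Sum>i\<in>UNIV. f i x)"

definition stacked_gradient :: "('n \<Rightarrow> real^'p \<Rightarrow> real^'p) \<Rightarrow> real^'p^'n \<Rightarrow> real^'p^'n" where
  "stacked_gradient g x = (\<chi> i. g i (x $ i))"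

text \<open>Both Barzilai-Borwein formulas, with their denominators required to be nonzero.\<close>

definition bb_step :: "real^'p \<Rightarrow> real^'p \<Rightarrow> real \<Rightarrow> bool" where
  "bb_step s z a \<longleftrightarrow>
     (s \<bullet> z \<noteq> 0 \<and> a = (s \<bullet> s) / (s \<bullet> z)) \<or> (z \<bullet> z \<noteq> 0 \<and> a = (s \<bullet> z) / (z \<bullet> z))"

text \<open>
  \<open>x\<close>, \<open>y\<close>, \<open>\<alpha>\<close> are the sequences of a run with weight matrix \<open>W\<close>, local gradients \<open>g\<close>
  and \<open>R\<close> inner consensus iterations.
\<close>

definition dgm_bb_c ::
  "real^'n^'n \<Rightarrow> ('n \<Rightarrow> real^'p \<Rightarrow> real^'p) \<Rightarrow> nat \<Rightarrow>
   (nat \<Rightarrow> real^'p^'n) \<Rightarrow> (nat \<Rightarrow> real^'p^'n) \<Rightarrow> (nat \<Rightarrow> 'n \<Rightarrow> real) \<Rightarrow> bool" where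
  "dgm_bb_c W g R x y \<alpha> \<longleftrightarrow>
     y 0 = stacked_gradient g (x 0) \<and>
     (\<forall>i. 0 < \<alpha> 0 i) \<and>
     (\<forall>k. x (Suc k) = matrix_power W R ** (x k - diag_matrix (\<alpha> k) ** y k)) \<and>
     (\<forall>k. y (Suc k) = matrix_power W R **
        (y k + stacked_gradient g (x (Suc k)) - stacked_gradient g (x k))) \<and>
     (\<forall>k\<ge>1. \<forall>i. bb_step (x k $ i - x (k - 1) $ i)
        (g i (x k $ i) - g i (x (k - 1) $ i)) (\<alpha> k i))"

text \<open>
  For runs of the algorithm under strong convexity the supremum is over a bounded set: for
  \<open>k \<ge> 1\<close> the Barzilai-Borwein steps are at most the inverse strong convexity constant.
\<close>

definition alpha_max :: "(nat \<Rightarrow> 'n \<Rightarrow> real) \<Rightarrow> real" where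
  "alpha_max \<alpha> = Sup (range (\<lambda>(k, i). \<alpha> k i))"

definition phi :: "real \<Rightarrow> int" where
  "phi x = (if x \<in> \<int> \<and> 0 < x then 1 else 0)"

definition G_alpha :: "nat \<Rightarrow> real \<Rightarrow> nat \<Rightarrow> real \<Rightarrow> real \<Rightarrow> real \<Rightarrow> real Matrix.mat" where
  "G_alpha n \<delta> R L \<mu> a = mat_of_rows_list 3
     [[\<delta>^R + \<delta>^R * L * a,           \<delta>^R * a,             \<delta>^R * L * sqrt n * a],
      [2 * \<delta>^R * L + \<delta>^R * L^2 * a, \<delta>^R + \<delta>^R * L * a, \<delta>^R * L^2 * sqrt n * a],
      [L / sqrt n * a,               1 / sqrt n * a,       1 - \<mu> / L]]"

text \<open>The library defines the spectral radius for complex matrices only.\<close>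

definition real_spectral_radius :: "real Matrix.mat \<Rightarrow> real" where
  "real_spectral_radius A = spectral_radius (map_mat complex_of_real A)"

end

theory Submission
  imports Defs
begin

text \<open>
  An iteration is tracked by three error measures: how far the rows of \<open>x k\<close> and of \<open>y k\<close> are
  from their row means, and how far the mean of \<open>x k\<close> is from the minimizer. Because \<open>W\<close> preserves
  row means and acts on the deviation from them as \<open>W - averaging_matrix\<close>, the \<open>R\<close> consensus
  iterations shrink the first two errors by \<open>\<delta> ^ R\<close>. The column sums of \<open>W\<close> also make the mean of
  \<open>y k\<close> equal to the mean of the current local gradients (\<open>gradient_tracking\<close>), so up to
  disagreement the mean of \<open>x k\<close> takes a gradient step for the average objective, whose step size is
  the mean of the local ones.

  Strong convexity and smoothness place every Barzilai-Borwein step in \<open>[1/L, 1/\<mu>]\<close>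
  (\<open>bb_step_bounds\<close>). The mean step size is therefore at least \<open>1/L\<close>, and by hypothesis it is at most
  \<open>2/L - \<mu>/L\<^sup>2\<close>; on exactly this interval a gradient step is guaranteed to contract by
  \<open>1 - \<mu>/L\<close> (\<open>gradient_step_contraction\<close>). This contraction, and the lower bound \<open>1/L\<close> for the second
  Barzilai-Borwein formula, come from cocoercivity of the gradient (\<open>cocoercive\<close>).

  From iteration one on this gives \<open>v (k + 1) \<le> G v k\<close> entrywise for the vector \<open>v k\<close> of the three errors and
  the nonnegative matrix \<open>G = G_alpha\<close> (\<open>dgm_step_errors\<close>). The constants \<open>c1, c2, c3\<close> and the bound
  on \<open>R\<close> ensure that \<open>G c < c\<close> entrywise for the positive vector \<open>c = (c1, c2, c3)\<close>, which forces the spectral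
  radius below one (\<open>real_spectral_radius_less_1\<close>). Finally \<open>v (k + 1) \<le> G ^ k v 1\<close>, and the powers of
  a matrix grow no faster than the powers of any number above its spectral radius
  (\<open>linear_recursion_geometric\<close>).
\<close>

(* From here on the dot product always means the inner product of vectors. *)
no_notation scalar_prod (infix "\<bullet>" 70)

section \<open>Functions between two quadratic bounds\<close>

text \<open>
  Strong convexity with constant \<open>m\<close> and smoothness with constant \<open>l\<close>, both expressed by function
  values, because in this form they pass to averages by summation.
\<close>
definition quadratic_bounds :: "real \<Rightarrow> real \<Rightarrow> ('a::real_inner \<Rightarrow> real) \<Rightarrow> ('a \<Rightarrow> 'a) \<Rightarrow> bool" where
  "quadratic_bounds m l F G \<longleftrightarrow>
     (\<forall>u v. F v + G v \<bullet> (u - v) + m / 2 * (norm (u - v))\<^sup>2 \<le> F u \<and>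
            F u \<le> F v + G v \<bullet> (u - v) + l / 2 * (norm (u - v))\<^sup>2)"

lemma quadratic_bounds_lower:
  "quadratic_bounds m l F G \<Longrightarrow> F v + G v \<bullet> (u - v) + m / 2 * (norm (u - v))\<^sup>2 \<le> F u"
  by (simp add: quadratic_bounds_def)

lemma quadratic_bounds_upper:
  "quadratic_bounds m l F G \<Longrightarrow> F u \<le> F v + G v \<bullet> (u - v) + l / 2 * (norm (u - v))\<^sup>2"
  by (simp add: quadratic_bounds_def)

text \<open>
  Along the segment from \<open>v\<close> to \<open>u\<close> the difference between \<open>F\<close> and the quadratic upper model is
  nonincreasing, since the Lipschitz bound on the gradient makes its derivative nonpositive.
\<close>
lemma descent_lemma:
  fixes F :: "'a::real_inner \<Rightarrow> real"
  assumes gradient: "\<And>u. GDERIV F u :> G u"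
    and smooth: "\<And>u v. norm (G u - G v) \<le> l * norm (u - v)"
  shows "F u \<le> F v + G v \<bullet> (u - v) + l / 2 * (norm (u - v))\<^sup>2"
proof -
  define e where "e = u - v"
  define h where "h t = F (v + t *\<^sub>R e) - t * (G v \<bullet> e) - l / 2 * t\<^sup>2 * (norm e)\<^sup>2" for t
  have line: "((\<lambda>t. F (v + t *\<^sub>R e)) has_derivative (\<lambda>s. (s *\<^sub>R e) \<bullet> G (v + t *\<^sub>R e))) (at t)" for t
  proof -
    have "((\<lambda>t. v + t *\<^sub>R e) has_derivative (\<lambda>s. s *\<^sub>R e)) (at t)"
      by (auto intro!: derivative_eq_intros)
    moreover have "(F has_derivative (\<lambda>h. h \<bullet> G (v + t *\<^sub>R e))) (at (v + t *\<^sub>R e))"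
      using gradient by (simp add: gderiv_def)
    ultimately show ?thesis
      using has_derivative_compose by blast
  qed
  have deriv: "(h has_real_derivative ((G (v + t *\<^sub>R e) - G v) \<bullet> e - l * t * (norm e)\<^sup>2)) (at t)" for t
  proof -
    have "((\<lambda>t. F (v + t *\<^sub>R e)) has_real_derivative (G (v + t *\<^sub>R e) \<bullet> e)) (at t)"
      unfolding has_field_derivative_def
      by (rule has_derivative_eq_rhs[OF line]) (auto simp: fun_eq_iff inner_commute)
    then show ?thesis
      unfolding h_def by (auto intro!: derivative_eq_intros simp: inner_diff_left)
  qed
  have nonpos: "(G (v + t *\<^sub>R e) - G v) \<bullet> e - l * t * (norm e)\<^sup>2 \<le> 0" if "0 \<le> t" for t
  proof -
    have "(G (v + t *\<^sub>R e) - G v) \<bullet> e \<le> norm (G (v + t *\<^sub>R e) - G v) * norm e"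
      by (rule norm_cauchy_schwarz)
    also have "\<dots> \<le> (l * norm ((v + t *\<^sub>R e) - v)) * norm e"
      by (intro mult_right_mono smooth) auto
    also have "\<dots> = l * t * (norm e)\<^sup>2"
      using that by (simp add: power2_eq_square)
    finally show ?thesis by simp
  qed
  have "h 1 \<le> h 0"
    by (rule DERIV_nonpos_imp_nonincreasing) (use deriv nonpos in force)+
  then show ?thesis
    by (simp add: h_def e_def)
qed

lemma quadratic_bounds_avg_objective:
  fixes f :: "'n::finite \<Rightarrow> real^'p \<Rightarrow> real"
  assumes "\<And>i. quadratic_bounds m l (f i) (g i)"
  shows "quadratic_bounds m l (avg_objective f) (\<lambda>u. (1 / real CARD('n)) *\<^sub>R (\<Sum>i\<in>UNIV. g i u))"
proof -
  have avg: "(1 / real CARD('n)) * (\<Sum>i\<in>UNIV. f i v + g i v \<bullet> (u - v) + c) =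
      avg_objective f v + ((1 / real CARD('n)) *\<^sub>R (\<Sum>i\<in>UNIV. g i v)) \<bullet> (u - v) + c" for u v c
    by (simp add: avg_objective_def sum.distrib inner_sum_left distrib_left)
  show ?thesis
    unfolding quadratic_bounds_def avg[symmetric]
    unfolding avg_objective_def
    by (intro allI conjI mult_left_mono sum_mono)
      (simp_all only: quadratic_bounds_lower[OF assms] quadratic_bounds_upper[OF assms],
        simp_all)
qed

text \<open>Each inequality is the sum of a quadratic bound and the same bound with \<open>u\<close> and \<open>v\<close> exchanged.\<close>
lemma gradient_monotone:
  assumes "quadratic_bounds m l F G"
  shows "m * (norm (u - v))\<^sup>2 \<le> (G u - G v) \<bullet> (u - v)"
    and "(G u - G v) \<bullet> (u - v) \<le> l * (norm (u - v))\<^sup>2"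
  using quadratic_bounds_lower[OF assms, of u v] quadratic_bounds_lower[OF assms, of v u]
    quadratic_bounds_upper[OF assms, of u v] quadratic_bounds_upper[OF assms, of v u]
  by (simp_all add: inner_diff norm_minus_commute algebra_simps)

text \<open>
  The argument of Baillon and Haddad, applied to \<open>F - m/2 \<parallel>\<cdot>\<parallel>\<^sup>2\<close>, which is convex and smooth with
  constant \<open>l - m\<close>. The upper bound at \<open>u\<close> minus the lower bound at \<open>v\<close> is a nonnegative quadratic
  function of the third point; its minimum strengthens the lower bound by a multiple of the squared
  norm of the gradient difference. Adding the result to the one with \<open>u\<close> and \<open>v\<close> exchanged
  removes the function values. The degenerate case \<open>m = l\<close> has
  to be excluded because the minimizing step has length proportional to \<open>1 / (l - m)\<close>.
\<close>
lemma cocoercive_strict: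
  assumes qb: "quadratic_bounds m l F G" and "m < l"
  shows "0 \<le> ((G u - G v) - m *\<^sub>R (u - v)) \<bullet> (l *\<^sub>R (u - v) - (G u - G v))"
proof -
  have bregman: "(norm ((G u - G v) - m *\<^sub>R (u - v)))\<^sup>2 / (2 * (l - m))
      \<le> F u - F v - G v \<bullet> (u - v) - m / 2 * (norm (u - v))\<^sup>2" for u v
  proof -
    define K where "K = l - m"
    define e where "e = u - v"
    define d where "d = (G u - G v) - m *\<^sub>R e"
    (* the minimizer of the upper bound at u minus the lower bound at v *)
    define w where "w = u - (1 / K) *\<^sub>R d"
    have K: "0 < K" using \<open>m < l\<close> by (simp add: K_def)
    have wu: "w - u = - (1 / K) *\<^sub>R d" and wv: "w - v = e - (1 / K) *\<^sub>R d"
      by (simp_all add: w_def e_def)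
    have Gu: "G u = G v + d + m *\<^sub>R e" by (simp add: d_def)
    have lower: "F v + (G v \<bullet> e - (G v \<bullet> d) / K) + m / 2 * (norm (e - (1 / K) *\<^sub>R d))\<^sup>2 \<le> F w"
      using quadratic_bounds_lower[OF qb, of v w] by (simp add: wv inner_diff_right)
    have upper: "F w \<le> F u - (G v \<bullet> d + d \<bullet> d + m * (e \<bullet> d)) / K + l / 2 * (norm ((1 / K) *\<^sub>R d))\<^sup>2"
      using quadratic_bounds_upper[OF qb, of w u] by (simp add: wu Gu inner_add_left add_divide_distrib)
    have n1: "(norm (e - (1 / K) *\<^sub>R d))\<^sup>2 = (norm e)\<^sup>2 - 2 * (e \<bullet> d) / K + (d \<bullet> d) / K\<^sup>2"
      by (simp only: power2_norm_eq_inner)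
        (simp add: inner_diff inner_commute power2_eq_square field_simps)
    have n2: "(norm ((1 / K) *\<^sub>R d))\<^sup>2 = (d \<bullet> d) / K\<^sup>2"
      by (simp only: power2_norm_eq_inner) (simp add: power2_eq_square)
    have "F v + G v \<bullet> e + m / 2 * (norm e)\<^sup>2 + (d \<bullet> d) / K - (l - m) / 2 * ((d \<bullet> d) / K\<^sup>2) \<le> F u"
      using order_trans[OF lower upper] unfolding n1 n2
      by (simp add: algebra_simps add_divide_distrib diff_divide_distrib)
    moreover have "(d \<bullet> d) / K - (l - m) / 2 * ((d \<bullet> d) / K\<^sup>2) = (d \<bullet> d) / (2 * K)"
      using K by (simp add: K_def[symmetric] power2_eq_square field_simps)
    ultimately show ?thesis
      by (simp add: d_def e_def K_def power2_norm_eq_inner)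
  qed
  define e d K where defs: "e = u - v" "d = (G u - G v) - m *\<^sub>R (u - v)" "K = l - m"
  have "(norm d)\<^sup>2 / (2 * K) + (norm d)\<^sup>2 / (2 * K) \<le> (G u - G v) \<bullet> e - m * (norm e)\<^sup>2"
  proof -
    have "(G v - G u) - m *\<^sub>R (v - u) = - d" by (simp add: defs algebra_simps)
    then have "(norm d)\<^sup>2 / (2 * K) \<le> F v - F u - G u \<bullet> (v - u) - m / 2 * (norm (v - u))\<^sup>2"
      using bregman[of v u] by (simp only: defs norm_minus_cancel)
    moreover have "(norm d)\<^sup>2 / (2 * K) \<le> F u - F v - G v \<bullet> (u - v) - m / 2 * (norm (u - v))\<^sup>2"
      using bregman[of u v] by (simp add: defs)
    ultimately show ?thesis
      by (simp add: defs norm_minus_commute[of v u] inner_diff algebra_simps)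
  qed
  also have "(G u - G v) \<bullet> e - m * (norm e)\<^sup>2 = d \<bullet> e"
    by (simp add: defs power2_norm_eq_inner inner_diff_left)
  finally have "(norm d)\<^sup>2 / K \<le> d \<bullet> e"
    by simp
  moreover have "0 < K" using \<open>m < l\<close> by (simp add: defs(3))
  ultimately have "(norm d)\<^sup>2 \<le> K * (d \<bullet> e)"
    by (simp add: field_simps)
  moreover have "d \<bullet> (l *\<^sub>R e - (G u - G v)) = K * (d \<bullet> e) - (norm d)\<^sup>2"
    by (simp add: defs power2_norm_eq_inner inner_diff algebra_simps)
  ultimately show ?thesis by (simp add: defs)
qed

text \<open>
  If \<open>m = l\<close>, the strict case applies to the pair \<open>m\<close>, \<open>l + 1\<close>; with \<open>e = u - v\<close>
  and \<open>d = G u - G v\<close> its excess over the claim is \<open>(d - l e) \<bullet> e\<close>, which is zero because the two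
  bounds of \<open>gradient_monotone\<close> coincide.
\<close>
lemma cocoercive:
  assumes qb: "quadratic_bounds m l F G" and "m \<le> l"
  shows "0 \<le> ((G u - G v) - m *\<^sub>R (u - v)) \<bullet> (l *\<^sub>R (u - v) - (G u - G v))"
proof (cases "m < l")
  case True
  then show ?thesis using cocoercive_strict[OF qb] by blast
next
  case False
  define e d where defs: "e = u - v" "d = G u - G v"
  have "m = l" using False \<open>m \<le> l\<close> by simp
  have "quadratic_bounds m (l + 1) F G"
    unfolding quadratic_bounds_def
    by (smt (verit, ccfv_SIG) divide_right_mono mult_right_mono qb quadratic_bounds_lower
        quadratic_bounds_upper zero_le_power2)
  from cocoercive_strict[OF this, of u v] \<open>m = l\<close>
  have "0 \<le> (d - l *\<^sub>R e) \<bullet> ((l + 1) *\<^sub>R e - d)" by (simp add: defs)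
  moreover have "(d - l *\<^sub>R e) \<bullet> e = 0"
    using gradient_monotone[OF qb, of u v] \<open>m = l\<close>
    by (simp add: defs inner_diff_left power2_norm_eq_inner)
  ultimately show ?thesis
    using \<open>m = l\<close> by (simp add: defs scaleR_add_left inner_add_right inner_diff_right)
qed

lemma cocoercive_norm:
  assumes "quadratic_bounds m l F G" and "m \<le> l"
  shows "(norm (G u - G v))\<^sup>2 + l * m * (norm (u - v))\<^sup>2 \<le> (l + m) * ((G u - G v) \<bullet> (u - v))"
proof -
  define e d where "e = u - v" and "d = G u - G v"
  have "0 \<le> (d - m *\<^sub>R e) \<bullet> (l *\<^sub>R e - d)"
    using cocoercive[OF assms, of u v] by (simp add: e_def d_def)
  then show ?thesis
    unfolding e_def[symmetric] d_def[symmetric] power2_norm_eq_inner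
    by (simp add: inner_diff inner_commute algebra_simps)
qed

text \<open>
  The two Barzilai-Borwein quotients are inverse curvatures along the last displacement. That the
  second quotient is at least \<open>1/l\<close> is cocoercivity; the remaining bounds need only
  monotonicity and the Cauchy-Schwarz inequality.
\<close>
lemma bb_step_bounds:
  fixes G :: "real^'p \<Rightarrow> real^'p"
  assumes qb: "quadratic_bounds m l F G" and m: "0 < m" "m \<le> l"
    and bb: "bb_step (u - v) (G u - G v) a"
  shows "1 / l \<le> a" "a \<le> 1 / m"
proof -
  define s z where "s = u - v" and "z = G u - G v"
  have l: "0 < l" using m by simp
  have sz: "m * (s \<bullet> s) \<le> s \<bullet> z" "s \<bullet> z \<le> l * (s \<bullet> s)"
    using gradient_monotone[OF qb, of u v]
    by (simp_all add: s_def z_def power2_norm_eq_inner inner_commute)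
  have "z \<bullet> z + l * m * (s \<bullet> s) \<le> (l + m) * (s \<bullet> z)"
    using cocoercive_norm[OF qb m(2), of u v]
    by (simp add: s_def z_def power2_norm_eq_inner inner_commute)
  moreover have "m * (s \<bullet> z) \<le> m * (l * (s \<bullet> s))"
    using sz(2) m(1) by (intro mult_left_mono) auto
  ultimately have zz_le: "z \<bullet> z \<le> l * (s \<bullet> z)"
    by (simp add: algebra_simps)
  have sz_le: "m * (s \<bullet> z) \<le> z \<bullet> z"
  proof (cases "s = 0")
    case False
    have cs: "s \<bullet> z \<le> norm s * norm z" by (rule norm_cauchy_schwarz)
    have "norm s * (m * norm s) \<le> norm s * norm z"
      using order_trans[OF sz(1) cs] by (simp add: dot_square_norm power2_eq_square algebra_simps)
    then have "m * norm s \<le> norm z" using False by simp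
    then have "m * norm s * norm z \<le> norm z * norm z" by (intro mult_right_mono) auto
    moreover have "m * (s \<bullet> z) \<le> m * (norm s * norm z)"
      using cs m(1) by (intro mult_left_mono) auto
    ultimately show ?thesis by (simp add: dot_square_norm power2_eq_square algebra_simps)
  qed simp
  have sz_nonneg: "0 \<le> s \<bullet> z"
    using sz(1) m(1) by (smt (verit) inner_ge_zero mult_nonneg_nonneg)
  have "1 / l \<le> a \<and> a \<le> 1 / m"
    using bb unfolding bb_step_def s_def[symmetric] z_def[symmetric]
  proof (elim disjE conjE)
    assume "s \<bullet> z \<noteq> 0" and a: "a = (s \<bullet> s) / (s \<bullet> z)"
    then have "0 < s \<bullet> z" using sz_nonneg by simp
    then show ?thesis using sz l m(1) unfolding a by (simp add: field_simps)
  next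
    assume "z \<bullet> z \<noteq> 0" and a: "a = (s \<bullet> z) / (z \<bullet> z)"
    then have "0 < z \<bullet> z" by (simp add: less_le)
    then show ?thesis using sz_le zz_le l m(1) unfolding a by (simp add: field_simps)
  qed
  then show "1 / l \<le> a" "a \<le> 1 / m" by auto
qed

text \<open>
  A step of size \<open>a \<ge> 0\<close> changes distances by a factor of at most \<open>max \<bar>1 - a m\<bar> \<bar>1 - a l\<bar>\<close>. The lower bound on \<open>a\<close> makes the first
  of these at most \<open>1 - m/l\<close>, and the upper bound is the value of \<open>a\<close> at which the second
  reaches \<open>1 - m/l\<close>.
\<close>
lemma gradient_step_contraction:
  assumes qb: "quadratic_bounds m l F G" and m: "0 < m" "m \<le> l"
    and a: "1 / l \<le> a" "a \<le> 2 / l - m / l\<^sup>2"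
  shows "norm ((u - v) - a *\<^sub>R (G u - G v)) \<le> (1 - m / l) * norm (u - v)"
proof -
  define e d where "e = u - v" and "d = G u - G v"
  define q where "q = 1 - m / l"
  have l: "0 < l" using m by simp
  have a_pos: "0 < a" using a(1) l by (smt (verit) divide_pos_pos)
  have q: "0 \<le> q" using m l by (simp add: q_def)
  have al: "1 \<le> a * l" using a(1) l by (simp add: field_simps)
  have "a * l \<le> (2 / l - m / l\<^sup>2) * l" using a(2) l by (intro mult_right_mono) auto
  also have "\<dots> = 1 + q" using l by (simp add: q_def power2_eq_square field_simps)
  finally have al': "a * l - 1 \<le> q" by simp
  have "(m / l) * 1 \<le> (m / l) * (a * l)" using al m l by (intro mult_left_mono) auto
  then have am: "1 - a * m \<le> q" using l by (simp add: q_def mult.commute)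
  have de: "m * (e \<bullet> e) \<le> d \<bullet> e" "d \<bullet> e \<le> l * (e \<bullet> e)"
    using gradient_monotone[OF qb, of u v] by (simp_all add: e_def d_def power2_norm_eq_inner)
  have dd: "d \<bullet> d \<le> (l + m) * (d \<bullet> e) - l * m * (e \<bullet> e)"
    using cocoercive_norm[OF qb m(2), of u v] by (simp add: e_def d_def power2_norm_eq_inner)
  have "(norm (e - a *\<^sub>R d))\<^sup>2 = e \<bullet> e - 2 * a * (d \<bullet> e) + a\<^sup>2 * (d \<bullet> d)"
    by (simp only: power2_norm_eq_inner)
      (simp add: inner_diff inner_commute power2_eq_square algebra_simps)
  also have "\<dots> \<le> e \<bullet> e - 2 * a * (d \<bullet> e) + a\<^sup>2 * ((l + m) * (d \<bullet> e) - l * m * (e \<bullet> e))"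
    using dd by (intro add_left_mono mult_left_mono) auto
  also have "\<dots> = (1 - a\<^sup>2 * (l * m)) * (e \<bullet> e) + a * (a * (l + m) - 2) * (d \<bullet> e)"
    by (simp add: power2_eq_square algebra_simps)
  (* The bound is affine in the product of d and e, which lies between m and l times the square of e,
     so the worst case is at one of these two ends. *)
  also have "\<dots> \<le> q\<^sup>2 * (e \<bullet> e)"
  proof (cases "2 \<le> a * (l + m)")
    case True
    have "a * (a * (l + m) - 2) * (d \<bullet> e) \<le> a * (a * (l + m) - 2) * (l * (e \<bullet> e))"
      using True a_pos de by (intro mult_left_mono) auto
    then have "(1 - a\<^sup>2 * (l * m)) * (e \<bullet> e) + a * (a * (l + m) - 2) * (d \<bullet> e)
        \<le> (a * l - 1)\<^sup>2 * (e \<bullet> e)"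
      by (simp add: power2_eq_square algebra_simps)
    also have "\<dots> \<le> q\<^sup>2 * (e \<bullet> e)"
      using al al' by (intro mult_right_mono power_mono) auto
    finally show ?thesis .
  next
    case False
    have "a * (a * (l + m) - 2) * (d \<bullet> e) \<le> a * (a * (l + m) - 2) * (m * (e \<bullet> e))"
      using False a_pos de by (intro mult_left_mono_neg) (auto simp: mult_nonneg_nonpos)
    then have "(1 - a\<^sup>2 * (l * m)) * (e \<bullet> e) + a * (a * (l + m) - 2) * (d \<bullet> e)
        \<le> (1 - a * m)\<^sup>2 * (e \<bullet> e)"
      by (simp add: power2_eq_square algebra_simps)
    also have "\<dots> \<le> q\<^sup>2 * (e \<bullet> e)"
    proof -
      have "a * m + a * m \<le> 2"
      proof -
        have "a * m \<le> a * l" using a_pos m by (intro mult_left_mono) auto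
        with False show ?thesis by (simp add: distrib_left)
      qed
      then show ?thesis
        using am by (intro mult_right_mono power_mono) auto
    qed
    finally show ?thesis .
  qed
  also have "\<dots> = (q * norm e)\<^sup>2" by (simp add: power_mult_distrib power2_norm_eq_inner)
  finally have "norm (e - a *\<^sub>R d) \<le> q * norm e"
    by (rule power2_le_imp_le) (use q in simp)
  then show ?thesis by (simp add: e_def d_def q_def)
qed

text \<open>The space \<open>real^'p\<close> contains a vector of norm one, so the two bounds can be compared at distance one.\<close>
lemma strong_convexity_le_smoothness:
  fixes F :: "real^'p \<Rightarrow> real"
  assumes "quadratic_bounds m l F G"
  shows "m \<le> l"
  using quadratic_bounds_lower[OF assms, of 0 "axis undefined 1"]
    quadratic_bounds_upper[OF assms, of "axis undefined 1" 0]
  by simp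

lemma minimizer_iff_gradient_zero:
  assumes qb: "quadratic_bounds m l F G" and "0 < m" and zero: "G w = 0"
  shows "is_arg_min F (\<lambda>_. True) u \<longleftrightarrow> u = w"
proof -
  have "F w + m / 2 * (norm (u - w))\<^sup>2 \<le> F u" for u
    using quadratic_bounds_lower[OF qb, of w u] zero by simp
  moreover have "0 \<le> m / 2 * (norm (u - w))\<^sup>2" for u using \<open>0 < m\<close> by simp
  moreover have "0 < m / 2 * (norm (u - w))\<^sup>2" if "u \<noteq> w" for u using \<open>0 < m\<close> that by simp
  ultimately show ?thesis
    unfolding is_arg_min_def by (smt (verit))
qed

text \<open>A zero of the gradient is a fixed point of the gradient step, which is a contraction.\<close>
lemma gradient_zero_exists:
  fixes F :: "real^'p \<Rightarrow> real"
  assumes qb: "quadratic_bounds m l F G" and "0 < m"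
  shows "\<exists>w. G w = 0"
proof -
  have ml: "m \<le> l" using strong_convexity_le_smoothness[OF qb] .
  then have l: "0 < l" using \<open>0 < m\<close> by simp
  (* the shortest admissible step size, 1 / l *)
  have "1 / l \<le> 2 / l - m / l\<^sup>2" using ml l by (simp add: field_simps power2_eq_square)
  then have "norm ((u - v) - (1 / l) *\<^sub>R (G u - G v)) \<le> (1 - m / l) * norm (u - v)" for u v
    by (intro gradient_step_contraction[OF qb \<open>0 < m\<close> ml]) auto
  then have "\<forall>u v. dist (u - (1 / l) *\<^sub>R G u) (v - (1 / l) *\<^sub>R G v) \<le> (1 - m / l) * dist u v"
    by (simp add: dist_norm scaleR_diff_right algebra_simps)
  moreover have "0 \<le> 1 - m / l" "1 - m / l < 1" using ml l \<open>0 < m\<close> by auto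
  ultimately have "\<exists>!w. w - (1 / l) *\<^sub>R G w = w"
    by (intro banach_fix_type) auto
  then show ?thesis using l by auto
qed

section \<open>Row means and consensus\<close>

definition row_mean :: "real^'p^'n \<Rightarrow> real^'p" where
  "row_mean X = (1 / real CARD('n)) *\<^sub>R (\<Sum>i\<in>UNIV. X $ i)"

definition disagreement :: "real^'p^'n \<Rightarrow> real^'p^'n" where
  "disagreement X = X - (\<chi> i. row_mean X)"

lemma row_mean_linear:
  "row_mean (X + Y) = row_mean X + row_mean Y"
  "row_mean (X - Y) = row_mean X - row_mean Y"
  by (simp_all add: row_mean_def sum.distrib sum_subtractf scaleR_add_right scaleR_diff_right)

lemma row_mean_const [simp]: "row_mean ((\<chi> i. u) :: real^'p^'n) = u"
  by (simp add: row_mean_def sum_constant_scaleR del: sum_constant)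

lemma norm_sq_rows: "(norm X)\<^sup>2 = (\<Sum>i\<in>UNIV. (norm (X $ i))\<^sup>2)" for X :: "'a::real_normed_vector^'n"
  by (simp add: norm_vec_def L2_set_def sum_nonneg)

lemma norm_const_rows: "norm ((\<chi> i. u) :: real^'p^'n) = sqrt (real CARD('n)) * norm u"
  unfolding norm_vec_def[of "\<chi> i. u"] L2_set_def by (simp add: real_sqrt_mult)

lemma norm_le_rowwise:
  fixes X :: "'a::real_normed_vector^'n" and Y :: "'b::real_normed_vector^'n"
  assumes "\<And>i. norm (X $ i) \<le> c * norm (Y $ i)" and "0 \<le> c"
  shows "norm X \<le> c * norm Y"
proof -
  have "norm X \<le> L2_set (\<lambda>i. c * norm (Y $ i)) UNIV"
    unfolding norm_vec_def by (intro L2_set_mono assms) auto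
  also have "\<dots> = c * norm Y"
    unfolding norm_vec_def using \<open>0 \<le> c\<close> by (simp add: L2_set_right_distrib)
  finally show ?thesis .
qed

text \<open>The constant part and the deviation from the row mean are orthogonal for the Frobenius inner product.\<close>
lemma norm_pythagoras:
  fixes X :: "real^'p^'n"
  shows "(norm X)\<^sup>2 = real CARD('n) * (norm (row_mean X))\<^sup>2 + (norm (disagreement X))\<^sup>2"
proof -
  let ?m = "row_mean X"
  have m: "(\<Sum>i\<in>UNIV. X $ i) = real CARD('n) *\<^sub>R ?m" by (simp add: row_mean_def)
  have "(norm (disagreement X))\<^sup>2
      = (\<Sum>i\<in>UNIV. inner (X $ i - ?m) (X $ i - ?m))"
    unfolding norm_sq_rows[of "disagreement X"] by (simp add: disagreement_def power2_norm_eq_inner)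
  also have "\<dots> = (\<Sum>i\<in>UNIV. inner (X $ i) (X $ i) - 2 * inner (X $ i) ?m + inner ?m ?m)"
    by (intro sum.cong refl) (simp add: inner_diff_left inner_diff_right inner_commute)
  also have "\<dots> = (norm X)\<^sup>2 - 2 * inner (\<Sum>i\<in>UNIV. X $ i) ?m + real CARD('n) * inner ?m ?m"
    unfolding norm_sq_rows[of X]
    by (simp add: power2_norm_eq_inner sum.distrib sum_subtractf inner_sum_left sum_distrib_left)
  finally show ?thesis
    unfolding m by (simp add: power2_norm_eq_inner)
qed

lemma norm_row_mean_le:
  fixes X :: "real^'p^'n"
  shows "norm (row_mean X) \<le> norm X / sqrt (real CARD('n))"
proof -
  have "real CARD('n) * (norm (row_mean X))\<^sup>2 \<le> (norm X)\<^sup>2"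
    using norm_pythagoras[of X] by simp
  then have "(sqrt (real CARD('n)) * norm (row_mean X))\<^sup>2 \<le> (norm X)\<^sup>2"
    by (simp add: power_mult_distrib)
  then have "sqrt (real CARD('n)) * norm (row_mean X) \<le> norm X"
    by (rule power2_le_imp_le) simp
  then show ?thesis by (simp add: field_simps)
qed

lemma norm_disagreement_le: "norm (disagreement X) \<le> norm X"
  by (rule power2_le_imp_le) (simp_all add: norm_pythagoras[of X])

lemma norm_le_disagreement_row_mean:
  fixes X :: "real^'p^'n"
  shows "norm (X - (\<chi> i. u)) \<le> norm (disagreement X) + sqrt (real CARD('n)) * norm (row_mean X - u)"
proof -
  have "X - (\<chi> i. u) = disagreement X + (\<chi> i. row_mean X - u)"
    unfolding disagreement_def by (subst Finite_Cartesian_Product.vec_eq_iff) simp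
  then show ?thesis
    by (metis norm_triangle_ineq norm_const_rows)
qed

text \<open>
  The squared Frobenius norm is the sum of the squared norms of the columns, and each
  column of the product is the image of a column of \<open>X\<close>.
\<close>
lemma norm_matrix_mult_le:
  fixes A :: "real^'n^'m" and X :: "real^'p^'n"
  shows "norm (A ** X) \<le> spectral_norm A * norm X"
proof -
  have frob: "(norm Z)\<^sup>2 = (\<Sum>j\<in>UNIV. (norm (column j Z))\<^sup>2)" for Z :: "real^'p^'k"
  proof -
    have "(norm Z)\<^sup>2 = (\<Sum>i\<in>UNIV. \<Sum>j\<in>UNIV. (norm (Z $ i $ j))\<^sup>2)"
      unfolding norm_sq_rows ..
    also have "\<dots> = (\<Sum>j\<in>UNIV. \<Sum>i\<in>UNIV. (norm (Z $ i $ j))\<^sup>2)" by (rule sum.swap)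
    finally show ?thesis unfolding norm_sq_rows by (simp add: column_def)
  qed
  have bl: "bounded_linear (\<lambda>v. A *v v)" by (rule matrix_vector_mul_bounded_linear)
  have col: "column j (A ** X) = A *v column j X" for j
    by (simp add: column_def Finite_Cartesian_Product.vec_eq_iff matrix_matrix_mult_def matrix_vector_mult_def)
  have nonneg: "0 \<le> spectral_norm A" unfolding spectral_norm_def by (rule onorm_pos_le[OF bl])
  have "(norm (A ** X))\<^sup>2 \<le> (\<Sum>j\<in>UNIV. (spectral_norm A * norm (column j X))\<^sup>2)"
    unfolding frob col spectral_norm_def by (intro sum_mono power_mono onorm[OF bl]) auto
  also have "\<dots> = (spectral_norm A * norm X)\<^sup>2"
    by (simp add: power_mult_distrib frob[of X] sum_distrib_left)
  finally show ?thesis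
    by (rule power2_le_imp_le) (simp add: nonneg)
qed

lemma matrix_mult_diff_distrib_left: "A ** (X - Y) = A ** X - A ** Y"
  for A :: "'a::ring_1^'n^'m"
  by (simp add: Finite_Cartesian_Product.vec_eq_iff matrix_matrix_mult_def right_diff_distrib sum_subtractf)

lemma matrix_mult_diff_distrib_right: "(A - B) ** X = A ** X - B ** X"
  for A :: "'a::ring_1^'n^'m"
  by (simp add: Finite_Cartesian_Product.vec_eq_iff matrix_matrix_mult_def left_diff_distrib sum_subtractf)

lemma row_mean_doubly_stochastic:
  fixes X :: "real^'p^'n"
  assumes "doubly_stochastic W"
  shows "row_mean (W ** X) = row_mean X"
proof -
  have "(\<Sum>i\<in>UNIV. \<Sum>k\<in>UNIV. W $ i $ k * X $ k $ j) = (\<Sum>k\<in>UNIV. X $ k $ j)" for j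
  proof -
    have "(\<Sum>i\<in>UNIV. \<Sum>k\<in>UNIV. W $ i $ k * X $ k $ j) = (\<Sum>k\<in>UNIV. (\<Sum>i\<in>UNIV. W $ i $ k) * X $ k $ j)"
      by (subst sum.swap) (simp add: sum_distrib_right)
    then show ?thesis using assms by (simp add: doubly_stochastic_def)
  qed
  then show ?thesis
    by (simp add: row_mean_def Finite_Cartesian_Product.vec_eq_iff matrix_matrix_mult_def)
qed

lemma doubly_stochastic_mult_const:
  fixes u :: "real^'p"
  assumes "doubly_stochastic W"
  shows "W ** (\<chi> i. u) = (\<chi> i. u)"
  using assms
  by (simp add: doubly_stochastic_def Finite_Cartesian_Product.vec_eq_iff matrix_matrix_mult_def
      flip: sum_distrib_right)

lemma matrix_power_mult_const:
  "doubly_stochastic W \<Longrightarrow> matrix_power W R ** (\<chi> i. u) = (\<chi> i. u)" for u :: "real^'p"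
  by (induction R) (simp_all add: doubly_stochastic_mult_const flip: matrix_mul_assoc)

text \<open>
  \<open>W\<close> commutes with taking the deviation from the row mean, and the averaging matrix
  annihilates deviations, so it may be subtracted for free. This is where \<open>\<delta>\<close> enters.
\<close>
lemma disagreement_doubly_stochastic:
  fixes X :: "real^'p^'n"
  assumes "doubly_stochastic W"
  shows "disagreement (W ** X) = (W - averaging_matrix) ** disagreement X"
proof -
  have avg: "averaging_matrix ** Y = (\<chi> i. row_mean Y)" for Y :: "real^'p^'n"
    by (simp add: averaging_matrix_def row_mean_def Finite_Cartesian_Product.vec_eq_iff matrix_matrix_mult_def sum_distrib_left)
  have "row_mean (disagreement X) = 0"
    by (simp add: disagreement_def row_mean_linear)
  then have "averaging_matrix ** disagreement X = 0"
    by (simp add: avg Finite_Cartesian_Product.vec_eq_iff)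
  moreover have "W ** disagreement X = disagreement (W ** X)"
    by (simp add: disagreement_def row_mean_doubly_stochastic[OF assms] matrix_mult_diff_distrib_left
        doubly_stochastic_mult_const[OF assms])
  ultimately show ?thesis
    by (simp add: matrix_mult_diff_distrib_right)
qed

lemma row_mean_matrix_power:
  "doubly_stochastic W \<Longrightarrow> row_mean (matrix_power W R ** X) = row_mean X" for X :: "real^'p^'n"
  by (induction R) (simp_all add: row_mean_doubly_stochastic flip: matrix_mul_assoc)

lemma disagreement_matrix_power_le:
  fixes X :: "real^'p^'n"
  assumes "doubly_stochastic W"
  shows "norm (disagreement (matrix_power W R ** X))
    \<le> spectral_norm (W - averaging_matrix) ^ R * norm (disagreement X)"
proof (induction R)
  case (Suc R)
  let ?\<delta> = "spectral_norm (W - averaging_matrix)"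
  have "0 \<le> ?\<delta>"
    unfolding spectral_norm_def by (rule onorm_pos_le[OF matrix_vector_mul_bounded_linear])
  have "norm (disagreement (matrix_power W (Suc R) ** X))
      \<le> ?\<delta> * norm (disagreement (matrix_power W R ** X))"
    using norm_matrix_mult_le[of "W - averaging_matrix" "disagreement (matrix_power W R ** X)"]
    by (simp add: disagreement_doubly_stochastic[OF assms] flip: matrix_mul_assoc)
  also have "\<dots> \<le> ?\<delta> * (?\<delta> ^ R * norm (disagreement X))"
    using \<open>0 \<le> ?\<delta>\<close> Suc by (rule mult_left_mono[rotated])
  finally show ?case by (simp add: mult.assoc)
qed simp

text \<open>
  The mean is preserved and the deviation is not increased, so the Pythagorean identity applies.
\<close>
lemma norm_matrix_power_le:
  fixes X :: "real^'p^'n"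
  assumes ds: "doubly_stochastic W" and "spectral_norm (W - averaging_matrix) \<le> 1"
  shows "norm (matrix_power W R ** X) \<le> norm X"
proof -
  let ?\<delta> = "spectral_norm (W - averaging_matrix)"
  have "0 \<le> ?\<delta>"
    unfolding spectral_norm_def by (rule onorm_pos_le[OF matrix_vector_mul_bounded_linear])
  then have "norm (disagreement (matrix_power W R ** X)) \<le> 1 * norm (disagreement X)"
    using assms by (intro order_trans[OF disagreement_matrix_power_le] mult_right_mono power_le_one) auto
  then have "(norm (disagreement (matrix_power W R ** X)))\<^sup>2 \<le> (norm (disagreement X))\<^sup>2"
    by (intro power_mono) auto
  then have "(norm (matrix_power W R ** X))\<^sup>2 \<le> (norm X)\<^sup>2"
    unfolding norm_pythagoras[of X] norm_pythagoras[of "matrix_power W R ** X"]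
    by (simp add: row_mean_matrix_power[OF ds])
  then show ?thesis by (rule power2_le_imp_le) simp
qed

lemma diag_matrix_mult_row: "(diag_matrix a ** X) $ i = a i *\<^sub>R (X $ i)" for X :: "real^'p^'n"
  by (simp add: diag_matrix_def Finite_Cartesian_Product.vec_eq_iff matrix_matrix_mult_def if_distrib if_distribR cong: if_cong)

section \<open>Linear recursive inequalities with a nonnegative matrix\<close>

text \<open>
  The easy half of the Collatz-Wielandt characterization. For an eigenvector \<open>v\<close>, compare moduli in an
  entry where \<open>\<bar>v i\<bar> / c i\<close> is largest: \<open>A\<close> strictly decreases this weighted maximum norm.
\<close>
lemma real_spectral_radius_less_1:
  fixes A :: "real Matrix.mat"
  assumes A: "A \<in> carrier_mat n n" and "0 < n"
    and nonneg: "\<And>i j. i < n \<Longrightarrow> j < n \<Longrightarrow> 0 \<le> A $$ (i, j)"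
    and c_pos: "\<And>i. i < n \<Longrightarrow> 0 < c i"
    and decreased: "\<And>i. i < n \<Longrightarrow> (\<Sum>j<n. A $$ (i, j) * c j) < c i"
  shows "real_spectral_radius A < 1"
proof -
  let ?A = "map_mat complex_of_real A"
  have cA: "?A \<in> carrier_mat n n" using A by simp
  obtain k where k: "eigenvalue ?A k" and rho: "real_spectral_radius A = norm k"
    using spectral_radius_mem_max(1)[OF cA \<open>0 < n\<close>]
    by (auto simp: real_spectral_radius_def spectrum_def)
  obtain v where v: "v \<in> carrier_vec n" "v \<noteq> 0\<^sub>v n" and eig: "?A *\<^sub>v v = k \<cdot>\<^sub>v v"
    using k A by (auto simp: eigenvalue_def eigenvector_def)
  define w where "w i = norm (vec_index v i) / c i" for i
  have fin: "finite (w ` {..<n})" "w ` {..<n} \<noteq> {}" using \<open>0 < n\<close> by auto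
  define s where "s = Max (w ` {..<n})"
  obtain i where i: "i < n" and s: "s = w i"
    using Max_in[OF fin] by (auto simp: s_def)
  have le: "norm (vec_index v j) \<le> s * c j" if "j < n" for j
  proof -
    have "w j \<le> s" unfolding s_def using that fin by (intro Max_ge) auto
    then show ?thesis using c_pos[OF that] by (simp add: w_def field_simps)
  qed
  have s_pos: "0 < s"
  proof -
    obtain j where "j < n" "vec_index v j \<noteq> 0"
      using v by (metis carrier_vecD eq_vecI index_zero_vec(1) index_zero_vec(2))
    then have "0 < s * c j" using le[of j] by (smt (verit) zero_less_norm_iff)
    then show ?thesis using c_pos[OF \<open>j < n\<close>] by (simp add: zero_less_mult_iff)
  qed
  have "k * vec_index v i = vec_index (?A *\<^sub>v v) i"
    using eig i v by simp
  also have "\<dots> = (\<Sum>j<n. complex_of_real (A $$ (i, j)) * vec_index v j)"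
    using i v A by (auto simp: scalar_prod_def atLeast0LessThan intro!: sum.cong)
  finally have "norm k * norm (vec_index v i) \<le> (\<Sum>j<n. norm (complex_of_real (A $$ (i, j)) * vec_index v j))"
    by (metis norm_mult norm_sum)
  also have "\<dots> \<le> (\<Sum>j<n. A $$ (i, j) * (s * c j))"
    using nonneg[OF i] le by (intro sum_mono) (auto simp: norm_mult intro!: mult_left_mono)
  also have "\<dots> = s * (\<Sum>j<n. A $$ (i, j) * c j)"
    by (simp add: sum_distrib_left mult_ac)
  also have "\<dots> < s * c i"
    using decreased[OF i] s_pos by simp
  also have "\<dots> = norm (vec_index v i)"
    using c_pos[OF i] by (simp add: s w_def)
  finally have "norm k * norm (vec_index v i) < 1 * norm (vec_index v i)" by simp
  then have "norm k < 1"
    by (rule mult_right_less_imp_less) simp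
  then show ?thesis using rho by simp
qed

lemma real_spectral_radius_nonneg:
  assumes "A \<in> carrier_mat n n" and "0 < n"
  shows "0 \<le> real_spectral_radius A"
  using spectral_radius_mem_max(1)[of "map_mat complex_of_real A" n] assms
  by (auto simp: real_spectral_radius_def)

lemma pow_mat_smult:
  fixes A :: "'a::comm_ring_1 Matrix.mat"
  assumes A: "A \<in> carrier_mat n n"
  shows "(a \<cdot>\<^sub>m A) ^\<^sub>m k = a ^ k \<cdot>\<^sub>m (A ^\<^sub>m k)"
proof (induction k)
  case 0
  then show ?case using A by (intro eq_matI) auto
next
  case (Suc k)
  have "(a \<cdot>\<^sub>m A) ^\<^sub>m Suc k = (a ^ k \<cdot>\<^sub>m (A ^\<^sub>m k)) * (a \<cdot>\<^sub>m A)" by (simp add: Suc)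
  also have "\<dots> = a ^ Suc k \<cdot>\<^sub>m (A ^\<^sub>m Suc k)"
    using A by (intro eq_matI) (auto simp: mult_smult_distrib[of _ n n] mult_smult_assoc_mat[of _ n n] pow_carrier_mat)
  finally show ?case .
qed

lemma eigenvalue_smult:
  fixes A :: "'a::field Matrix.mat"
  assumes A: "A \<in> carrier_mat n n" and "a \<noteq> 0" and "eigenvalue (a \<cdot>\<^sub>m A) k"
  shows "eigenvalue A (k / a)"
proof -
  obtain v where v: "v \<in> carrier_vec n" "v \<noteq> 0\<^sub>v n" and eig: "(a \<cdot>\<^sub>m A) *\<^sub>v v = k \<cdot>\<^sub>v v"
    using assms(3) A by (auto simp: eigenvalue_def eigenvector_def)
  have "A *\<^sub>v v = (k / a) \<cdot>\<^sub>v v"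
  proof (rule eq_vecI)
    fix i assume "i < dim_vec ((k / a) \<cdot>\<^sub>v v)"
    then have i: "i < n" using v by simp
    have "a * vec_index (A *\<^sub>v v) i = vec_index ((a \<cdot>\<^sub>m A) *\<^sub>v v) i"
      using i A v by simp
    also have "\<dots> = k * vec_index v i" using i v by (simp add: eig)
    finally show "vec_index (A *\<^sub>v v) i = vec_index ((k / a) \<cdot>\<^sub>v v) i"
      using i v \<open>a \<noteq> 0\<close> by (simp add: field_simps)
  qed (use A v in auto)
  then show ?thesis using A v by (auto simp: eigenvalue_def eigenvector_def)
qed

text \<open>
  Gelfand's estimate. Dividing by \<open>r\<close> brings the spectral radius below one, and the powers of such a
  matrix are bounded, by its Jordan normal form.
\<close>
lemma pow_mat_entries_bounded:
  fixes A :: "real Matrix.mat"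
  assumes A: "A \<in> carrier_mat n n" and "0 < n" and r: "real_spectral_radius A < r"
  shows "\<exists>b. \<forall>k i j. i < n \<longrightarrow> j < n \<longrightarrow> \<bar>(A ^\<^sub>m k) $$ (i, j)\<bar> \<le> b * r ^ k"
proof -
  let ?A = "map_mat complex_of_real A"
  let ?B = "complex_of_real (1 / r) \<cdot>\<^sub>m ?A"
  have cA: "?A \<in> carrier_mat n n" and cB: "?B \<in> carrier_mat n n" using A by simp_all
  have r_pos: "0 < r" using real_spectral_radius_nonneg[OF A \<open>0 < n\<close>] r by simp
  (* an eigenvalue of A / r, multiplied by r, is an eigenvalue of A *)
  have "spectral_radius ?B < 1"
  proof -
    obtain k where k: "eigenvalue ?B k" and sr: "spectral_radius ?B = norm k"
      using spectral_radius_mem_max(1)[OF cB \<open>0 < n\<close>] by (auto simp: spectrum_def)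
    have "eigenvalue ?A (k / complex_of_real (1 / r))"
      using eigenvalue_smult[OF cA _ k] r_pos by simp
    then have "norm (k / complex_of_real (1 / r)) \<le> real_spectral_radius A"
      unfolding real_spectral_radius_def
      by (intro spectral_radius_mem_max(2)[OF cA \<open>0 < n\<close>]) (auto simp: spectrum_def)
    also have "\<dots> < r" by (rule r)
    finally show ?thesis using r_pos sr by (simp add: norm_divide norm_mult)
  qed
  then obtain b where b: "\<And>k. norm_bound (?B ^\<^sub>m k) b"
    using spectral_radius_jnf_norm_bound_less_1_upper_triangular[OF cB] by auto
  have "\<bar>(A ^\<^sub>m k) $$ (i, j)\<bar> \<le> b * r ^ k" if ij: "i < n" "j < n" for k i j
  proof -
    have dims: "A ^\<^sub>m k \<in> carrier_mat n n" by (rule pow_carrier_mat[OF A])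
    have "?B ^\<^sub>m k = complex_of_real (1 / r) ^ k \<cdot>\<^sub>m map_mat complex_of_real (A ^\<^sub>m k)"
      using pow_mat_smult[OF cA] of_real_hom.mat_hom_pow[OF A, where ?'a = complex] by simp
    moreover have "norm ((?B ^\<^sub>m k) $$ (i, j)) \<le> b"
      using b[of k, unfolded norm_bound_def, rule_format, of i j] ij
      by (simp only: carrier_matD[OF pow_carrier_mat[OF cB, of k]])
    ultimately have "norm (complex_of_real (1 / r) ^ k * complex_of_real ((A ^\<^sub>m k) $$ (i, j))) \<le> b"
      using ij carrier_matD[OF dims] by simp
    then show ?thesis using r_pos
      by (simp add: norm_mult norm_power norm_divide power_divide field_simps)
  qed
  then show ?thesis by blast
qed

lemma pow_mat_Suc_left:
  assumes A: "A \<in> carrier_mat n n"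
  shows "A ^\<^sub>m Suc k = A * A ^\<^sub>m k"
proof (induction k)
  case (Suc k)
  have "A ^\<^sub>m Suc (Suc k) = (A * A ^\<^sub>m k) * A" using Suc by simp
  also have "\<dots> = A * (A ^\<^sub>m k * A)"
    by (rule assoc_mult_mat[OF A pow_carrier_mat[OF A] A])
  finally show ?case by simp
qed (use A in simp)

lemma linear_recursion_bounded_by_powers:
  fixes A :: "real Matrix.mat" and v :: "nat \<Rightarrow> nat \<Rightarrow> real"
  assumes A: "A \<in> carrier_mat n n"
    and nonneg: "\<And>i j. i < n \<Longrightarrow> j < n \<Longrightarrow> 0 \<le> A $$ (i, j)"
    and step: "\<And>k i. i < n \<Longrightarrow> v (Suc k) i \<le> (\<Sum>j<n. A $$ (i, j) * v k j)"
  shows "i < n \<Longrightarrow> v k i \<le> (\<Sum>j<n. (A ^\<^sub>m k) $$ (i, j) * v 0 j)"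
proof (induction k arbitrary: i)
  case 0
  then have "(\<Sum>j<n. (1\<^sub>m n) $$ (i, j) * v 0 j) = (\<Sum>j<n. if j = i then v 0 j else 0)"
    by (intro sum.cong) auto
  also have "\<dots> = v 0 i" using 0 by simp
  finally show ?case using A by simp
next
  case (Suc k)
  have P: "A ^\<^sub>m k \<in> carrier_mat n n" by (rule pow_carrier_mat[OF A])
  have comm: "A ^\<^sub>m Suc k = A * A ^\<^sub>m k"
    by (rule pow_mat_Suc_left[OF A])
  have "v (Suc k) i \<le> (\<Sum>j<n. A $$ (i, j) * v k j)" using Suc.prems by (rule step)
  also have "\<dots> \<le> (\<Sum>j<n. A $$ (i, j) * (\<Sum>l<n. (A ^\<^sub>m k) $$ (j, l) * v 0 l))"
    using Suc nonneg by (intro sum_mono mult_left_mono) auto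
  also have "\<dots> = (\<Sum>l<n. (\<Sum>j<n. A $$ (i, j) * (A ^\<^sub>m k) $$ (j, l)) * v 0 l)"
    unfolding sum_distrib_left sum_distrib_right by (subst sum.swap) (simp add: mult_ac)
  also have "\<dots> = (\<Sum>l<n. (A ^\<^sub>m Suc k) $$ (i, l) * v 0 l)"
    unfolding comm using Suc.prems A P
    by (intro sum.cong) (auto simp: scalar_prod_def atLeast0LessThan)
  finally show ?case .
qed

text \<open>
  Nonnegativity of \<open>A\<close> allows the entrywise inequality to be iterated, which reduces the growth of
  \<open>v\<close> to that of the powers of \<open>A\<close>.
\<close>
lemma linear_recursion_geometric:
  fixes A :: "real Matrix.mat" and v :: "nat \<Rightarrow> nat \<Rightarrow> real"
  assumes A: "A \<in> carrier_mat n n" and "0 < n"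
    and nonneg: "\<And>i j. i < n \<Longrightarrow> j < n \<Longrightarrow> 0 \<le> A $$ (i, j)"
    and step: "\<And>k i. i < n \<Longrightarrow> v (Suc k) i \<le> (\<Sum>j<n. A $$ (i, j) * v k j)"
    and r: "real_spectral_radius A < r"
  shows "\<exists>M. \<forall>k. \<forall>i<n. v k i \<le> M * r ^ k"
proof -
  obtain b where b: "\<And>k i j. i < n \<Longrightarrow> j < n \<Longrightarrow> \<bar>(A ^\<^sub>m k) $$ (i, j)\<bar> \<le> b * r ^ k"
    using pow_mat_entries_bounded[OF A \<open>0 < n\<close> r] by blast
  have "v k i \<le> (\<Sum>j<n. b * \<bar>v 0 j\<bar>) * r ^ k" if i: "i < n" for k i
  proof -
    have "v k i \<le> (\<Sum>j<n. (A ^\<^sub>m k) $$ (i, j) * v 0 j)"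
      using A nonneg step i by (rule linear_recursion_bounded_by_powers)
    also have "\<dots> \<le> (\<Sum>j<n. (b * r ^ k) * \<bar>v 0 j\<bar>)"
    proof (rule sum_mono)
      fix j assume "j \<in> {..<n}"
      then have "\<bar>(A ^\<^sub>m k) $$ (i, j)\<bar> * \<bar>v 0 j\<bar> \<le> (b * r ^ k) * \<bar>v 0 j\<bar>"
        using b i by (intro mult_right_mono) auto
      then show "(A ^\<^sub>m k) $$ (i, j) * v 0 j \<le> (b * r ^ k) * \<bar>v 0 j\<bar>"
        by (metis abs_ge_self abs_mult order_trans)
    qed
    also have "\<dots> = (\<Sum>j<n. b * \<bar>v 0 j\<bar>) * r ^ k"
      by (simp add: sum_distrib_left mult_ac)
    finally show ?thesis .
  qed
  then show ?thesis by blast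
qed

section \<open>One iteration of the algorithm\<close>

lemma norm_stacked_gradient_diff_le:
  fixes x x' :: "real^'p^'n"
  assumes "\<And>i u v. norm (g i u - g i v) \<le> L * norm (u - v)" and "0 \<le> L"
  shows "norm (stacked_gradient g x - stacked_gradient g x') \<le> L * norm (x - x')"
  by (rule norm_le_rowwise) (use assms in \<open>auto simp: stacked_gradient_def\<close>)

text \<open>
  The three rows of the comparison matrix. All of them rest on \<open>\<parallel>y\<parallel> \<le> dy + L dx + L \<surd>n e\<close>, which holds
  because the mean of \<open>y\<close> is the mean of the local gradients at \<open>x\<close>, while the mean of the local gradients
  at the minimizer vanishes. In the third row the step of the mean is split into an exact gradient
  step with the mean step size, the error of evaluating the gradients at the rows of \<open>x\<close> instead of
  at their mean, and the effect of unequal rows of \<open>y\<close>.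
\<close>
lemma dgm_step_errors:
  fixes W :: "real^'n^'n" and x y x' y' :: "real^'p^'n" and g :: "'n::finite \<Rightarrow> real^'p \<Rightarrow> real^'p"
    and F :: "real^'p \<Rightarrow> real"
  defines "n \<equiv> real CARD('n)"
  assumes weights: "doubly_stochastic W"
    and delta: "\<delta> = spectral_norm (W - averaging_matrix)" "\<delta> \<le> 1"
    and smooth: "\<And>i u v. norm (g i u - g i v) \<le> L * norm (u - v)"
    and qb: "quadratic_bounds \<mu> L F (\<lambda>u. row_mean (stacked_gradient g ((\<chi> i. u) :: real^'p^'n)))"
    and mu: "0 < \<mu>" "\<mu> \<le> L"
    and zero: "row_mean (stacked_gradient g ((\<chi> i. w) :: real^'p^'n)) = 0"
    and tracking: "row_mean y = row_mean (stacked_gradient g x)"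
    and step: "\<And>i. 0 \<le> a i" "\<And>i. a i \<le> A"
    and avg_step: "1 / L \<le> (1 / n) * (\<Sum>i\<in>UNIV. a i)" "(1 / n) * (\<Sum>i\<in>UNIV. a i) \<le> 2 / L - \<mu> / L^2"
    and x': "x' = matrix_power W R ** (x - diag_matrix a ** y)"
    and y': "y' = matrix_power W R ** (y + stacked_gradient g x' - stacked_gradient g x)"
  defines "dx \<equiv> norm (disagreement x)" and "dy \<equiv> norm (disagreement y)"
    and "e \<equiv> norm (row_mean x - w)"
  shows "norm (disagreement x') \<le> \<delta>^R * (dx + A * (dy + L * dx + L * sqrt n * e))"
    and "norm (disagreement y') \<le> \<delta>^R * (dy + L * (2 * dx + A * (dy + L * dx + L * sqrt n * e)))"
    and "norm (row_mean x' - w) \<le> (1 - \<mu> / L) * e + A / sqrt n * (L * dx + dy)"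
proof -
  let ?W = "matrix_power W R" and ?D = "diag_matrix a" and ?s = "stacked_gradient g"
  let ?const = "\<lambda>u. (\<chi> i. u) :: real^'p^'n"
  define Y where "Y = dy + L * dx + L * sqrt n * e"
  have n: "0 < n" by (simp add: n_def)
  have L: "0 < L" using mu by simp
  have A: "0 \<le> A" using step by (meson order_trans)
  have delta_nonneg: "0 \<le> \<delta>"
    unfolding delta(1) spectral_norm_def by (rule onorm_pos_le[OF matrix_vector_mul_bounded_linear])
  have contract: "norm (disagreement (?W ** X)) \<le> \<delta>^R * norm (disagreement X)" for X :: "real^'p^'n"
    unfolding delta(1) by (rule disagreement_matrix_power_le[OF weights])
  have nonexp: "norm (?W ** X) \<le> norm X" for X :: "real^'p^'n"
    using norm_matrix_power_le[OF weights] delta by simp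
  have D_le: "norm (?D ** X) \<le> A * norm X" for X :: "real^'p^'n"
    by (rule norm_le_rowwise) (use step A in \<open>auto simp: diag_matrix_mult_row intro!: mult_right_mono\<close>)
  have s_le: "norm (?s X - ?s X') \<le> L * norm (X - X')" for X X'
    using norm_stacked_gradient_diff_le[OF smooth] L by simp
  have mean_le: "sqrt n * norm (row_mean X) \<le> norm X" for X :: "real^'p^'n"
    using norm_row_mean_le[of X] n by (simp add: field_simps n_def)
  have y_le: "norm y \<le> Y"
  proof -
    have "sqrt n * norm (row_mean y) \<le> norm (?s x - ?s (?const w))"
      using mean_le[of "?s x - ?s (?const w)"] by (simp add: row_mean_linear tracking zero)
    also have "\<dots> \<le> L * norm (x - ?const w)" by (rule s_le)
    also have "\<dots> \<le> L * (dx + sqrt n * e)"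
      unfolding dx_def e_def n_def using L
      by (intro mult_left_mono norm_le_disagreement_row_mean) auto
    finally have mean: "sqrt n * norm (row_mean y) \<le> L * (dx + sqrt n * e)" .
    have "y - ?const 0 = y" by (simp add: Finite_Cartesian_Product.vec_eq_iff)
    then have "norm y \<le> dy + sqrt n * norm (row_mean y)"
      using norm_le_disagreement_row_mean[of y 0] by (simp add: dy_def n_def)
    then show ?thesis using mean by (simp add: Y_def algebra_simps)
  qed
  have Dy_le: "norm (?D ** y) \<le> A * Y"
    using D_le[of y] mult_left_mono[OF y_le A] by simp
  have dis_diff: "disagreement (X - X') = disagreement X - disagreement X'" for X X' :: "real^'p^'n"
    unfolding disagreement_def
    by (subst Finite_Cartesian_Product.vec_eq_iff) (simp add: row_mean_linear)
  have dis_add: "disagreement (X + X') = disagreement X + disagreement X'" for X X' :: "real^'p^'n"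
    unfolding disagreement_def
    by (subst Finite_Cartesian_Product.vec_eq_iff) (simp add: row_mean_linear)

  have "norm (disagreement (x - ?D ** y)) \<le> dx + A * Y"
    unfolding dis_diff dx_def
    using norm_triangle_ineq4[of "disagreement x" "disagreement (?D ** y)"]
      norm_disagreement_le[of "?D ** y"] Dy_le by simp
  then have "\<delta>^R * norm (disagreement (x - ?D ** y)) \<le> \<delta>^R * (dx + A * Y)"
    using delta_nonneg by (intro mult_left_mono) auto
  then show "norm (disagreement x') \<le> \<delta>^R * (dx + A * (dy + L * dx + L * sqrt n * e))"
    using contract[of "x - ?D ** y"] by (simp add: x' Y_def)

  have move: "norm (x' - x) \<le> 2 * dx + A * Y"
  proof -
    have "?W ** x = ?W ** disagreement x + ?const (row_mean x)"
      by (simp add: disagreement_def matrix_mult_diff_distrib_left matrix_power_mult_const[OF weights])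
    then have eq: "x' - x = (?W ** disagreement x - disagreement x) - ?W ** (?D ** y)"
      by (simp add: x' disagreement_def matrix_mult_diff_distrib_left)
    have "norm (x' - x) \<le> norm (?W ** disagreement x) + norm (disagreement x) + norm (?W ** (?D ** y))"
      unfolding eq
      using norm_triangle_ineq4[of "?W ** disagreement x - disagreement x" "?W ** (?D ** y)"]
        norm_triangle_ineq4[of "?W ** disagreement x" "disagreement x"] by linarith
    then show ?thesis
      using nonexp[of "disagreement x"] nonexp[of "?D ** y"] Dy_le by (simp add: dx_def)
  qed
  have "norm (disagreement (y + ?s x' - ?s x)) \<le> dy + norm (disagreement (?s x' - ?s x))"
    unfolding dy_def add_diff_eq[symmetric] dis_add by (rule norm_triangle_ineq)
  also have "\<dots> \<le> dy + L * norm (x' - x)"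
    using norm_disagreement_le[of "?s x' - ?s x"] s_le[of x' x] by simp
  also have "\<dots> \<le> dy + L * (2 * dx + A * Y)"
    using move L by simp
  finally have "\<delta>^R * norm (disagreement (y + ?s x' - ?s x)) \<le> \<delta>^R * (dy + L * (2 * dx + A * Y))"
    using delta_nonneg by (intro mult_left_mono) auto
  then show "norm (disagreement y') \<le> \<delta>^R * (dy + L * (2 * dx + A * (dy + L * dx + L * sqrt n * e)))"
    using contract[of "y + ?s x' - ?s x"] by (simp add: y' Y_def)

  define b where "b = (1 / n) * (\<Sum>i\<in>UNIV. a i)"
  let ?G = "\<lambda>u. row_mean (?s (?const u))"
  have b: "0 \<le> b" "b \<le> A"
  proof -
    show "0 \<le> b" unfolding b_def using step n by (intro mult_nonneg_nonneg sum_nonneg) auto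
    have "(\<Sum>i\<in>UNIV. a i) \<le> (\<Sum>i\<in>(UNIV::'n set). A)" by (intro sum_mono step)
    then show "b \<le> A" using n by (simp add: b_def n_def field_simps)
  qed
  have mean_Dy: "row_mean (?D ** y) = row_mean (?D ** disagreement y) + b *\<^sub>R row_mean y"
  proof -
    have "?D ** y = ?D ** disagreement y + ?D ** ?const (row_mean y)"
      by (simp add: disagreement_def matrix_mult_diff_distrib_left)
    moreover have "row_mean (?D ** ?const u) = b *\<^sub>R u" for u
      by (simp add: row_mean_def diag_matrix_mult_row b_def n_def flip: scaleR_sum_left)
    ultimately show ?thesis by (simp add: row_mean_linear)
  qed
  let ?t1 = "(row_mean x - w) - b *\<^sub>R (?G (row_mean x) - ?G w)"
  let ?t2 = "b *\<^sub>R row_mean (?s x - ?s (?const (row_mean x)))"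
  let ?t3 = "row_mean (?D ** disagreement y)"
  have "row_mean x' - w = row_mean x - row_mean (?D ** y) - w"
    by (simp add: x' row_mean_matrix_power[OF weights] row_mean_linear)
  also have "\<dots> = ?t1 - ?t2 - ?t3"
    unfolding mean_Dy tracking zero by (simp add: row_mean_linear scaleR_diff_right algebra_simps)
  finally have eq: "row_mean x' - w = ?t1 - ?t2 - ?t3" .
  have "norm (row_mean x' - w) \<le> norm ?t1 + norm ?t2 + norm ?t3"
    unfolding eq using norm_triangle_ineq4[of "?t1 - ?t2" ?t3] norm_triangle_ineq4[of ?t1 ?t2] by linarith
  moreover have "norm ?t1 \<le> (1 - \<mu> / L) * e"
    unfolding e_def using avg_step by (intro gradient_step_contraction[OF qb mu]) (auto simp: b_def)
  moreover have "norm ?t2 \<le> A / sqrt n * (L * dx)"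
  proof -
    have "norm (?s x - ?s (?const (row_mean x))) \<le> L * dx"
      using s_le[of x "?const (row_mean x)"] by (simp add: dx_def disagreement_def)
    then have "norm (row_mean (?s x - ?s (?const (row_mean x)))) \<le> L * dx / sqrt n"
      using norm_row_mean_le[of "?s x - ?s (?const (row_mean x))"] n
      by (smt (verit) divide_right_mono n_def real_sqrt_ge_zero)
    then have "b * norm (row_mean (?s x - ?s (?const (row_mean x)))) \<le> A * (L * dx / sqrt n)"
      using b A by (intro mult_mono) auto
    then show ?thesis using b by simp
  qed
  moreover have "norm ?t3 \<le> A / sqrt n * dy"
  proof -
    have "norm ?t3 \<le> norm (?D ** disagreement y) / sqrt n"
      using norm_row_mean_le[of "?D ** disagreement y"] by (simp add: n_def)
    also have "\<dots> \<le> A * dy / sqrt n"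
      using D_le[of "disagreement y"] n by (intro divide_right_mono) (auto simp: dy_def)
    finally show ?thesis by simp
  qed
  ultimately show "norm (row_mean x' - w) \<le> (1 - \<mu> / L) * e + A / sqrt n * (L * dx + dy)"
    by (simp add: distrib_left)
qed

text \<open>
  The increments of the local gradients telescope, because multiplication by \<open>W\<close> keeps the row mean.
\<close>
lemma gradient_tracking:
  assumes weights: "doubly_stochastic W" and run: "dgm_bb_c W g R x y \<alpha>"
  shows "row_mean (y k) = row_mean (stacked_gradient g (x k))"
proof (induction k)
  case 0
  then show ?case using run by (simp add: dgm_bb_c_def)
next
  case (Suc k)
  then show ?case
    using run by (simp add: dgm_bb_c_def row_mean_matrix_power[OF weights] row_mean_linear)
qed

section \<open>The spectral radius of the comparison matrix\<close>

lemma G_alpha_carrier: "G_alpha n \<delta> R L \<mu> a \<in> carrier_mat 3 3"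
  by (simp add: G_alpha_def mat_of_rows_list_def carrier_matI)

lemma G_alpha_row_sum:
  fixes c :: "nat \<Rightarrow> real" and L :: real and n :: nat
  defines "S \<equiv> c 1 + L * c 0 + L * sqrt (real n) * c 2"
  shows "(\<Sum>j<3. G_alpha n \<delta> R L \<mu> a $$ (0, j) * c j) = \<delta>^R * (c 0 + a * S)"
    and "(\<Sum>j<3. G_alpha n \<delta> R L \<mu> a $$ (1, j) * c j) = \<delta>^R * (c 1 + L * (2 * c 0 + a * S))"
    and "(\<Sum>j<3. G_alpha n \<delta> R L \<mu> a $$ (2, j) * c j)
      = (1 - \<mu> / L) * c 2 + a / sqrt (real n) * (L * c 0 + c 1)"
  by (simp_all add: S_def G_alpha_def mat_of_rows_list_def numeral_3_eq_3 numeral_2_eq_2 power2_eq_square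
      algebra_simps add_divide_distrib)

lemma less_3_cases: "i < 3 \<Longrightarrow> i = 0 \<or> i = 1 \<or> i = (2::nat)"
  by auto

lemma G_alpha_nonneg:
  assumes "0 \<le> \<delta>" "0 < L" "\<mu> \<le> L" "0 \<le> a" "i < 3" "j < 3"
  shows "0 \<le> G_alpha n \<delta> R L \<mu> a $$ (i, j)"
  using less_3_cases[OF \<open>i < 3\<close>] less_3_cases[OF \<open>j < 3\<close>] assms
  by (elim disjE) (auto simp: G_alpha_def mat_of_rows_list_def numeral_2_eq_2)

text \<open>
  The inequality has to be strict. Rounding up provides this unless the quotient is an integer, and
  then \<open>phi\<close> adds one.
\<close>
lemma power_less_of_phi_bound:
  assumes \<delta>: "0 < \<delta>" "\<delta> < 1" and \<Delta>: "0 < \<Delta>" "\<Delta> < 1"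
    and R: "\<lceil>ln \<Delta> / ln \<delta>\<rceil> + phi (ln \<Delta> / ln \<delta>) \<le> int R"
  shows "\<delta> ^ R < \<Delta>"
proof -
  let ?q = "ln \<Delta> / ln \<delta>"
  have neg: "ln \<delta> < 0" "ln \<Delta> < 0" using \<delta> \<Delta> by simp_all
  then have q: "0 < ?q" by (simp add: divide_neg_neg)
  have "?q < real R"
  proof (cases "?q \<in> \<int>")
    case True
    then have "\<lceil>?q\<rceil> + 1 \<le> int R" using R q by (simp add: phi_def)
    then show ?thesis by linarith
  next
    case False
    then have "of_int \<lceil>?q\<rceil> \<noteq> ?q" by (metis Ints_of_int)
    then have "?q < of_int \<lceil>?q\<rceil>" by (simp add: less_le)
    moreover have "\<lceil>?q\<rceil> \<le> int R" using R False by (simp add: phi_def)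
    ultimately show ?thesis by linarith
  qed
  then have "real R * ln \<delta> < ln \<Delta>" using neg by (simp add: field_simps)
  then have "ln (\<delta> ^ R) < ln \<Delta>" using \<delta> by (simp add: ln_realpow)
  then show ?thesis using \<delta> \<Delta> by simp
qed

text \<open>
  For the vector \<open>(c1, c2, c3)\<close> the three rows of \<open>G c < c\<close> become, with \<open>a\<close> replaced by its upper bound
  \<open>1/\<mu>\<close>, the two upper bounds on \<open>\<delta> ^ R\<close> whose minimum is \<open>\<Delta>\<close>, and the lower bound on \<open>c3\<close>.
\<close>
lemma G_alpha_spectral_radius_less_1:
  fixes c1 c2 c3 C :: real
  assumes mu: "0 < \<mu>" "\<mu> \<le> L" and \<delta>: "0 < \<delta>" "\<delta> < 1" and n: "0 < n"
    and a: "0 \<le> a" "a \<le> 1 / \<mu>"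
    and c: "0 < c1" "0 < c2" and c3: "L * (L * c1 + c2) / (\<mu>^2 * sqrt (real n)) < c3"
    and C_def: "C = L * c1 + c2 + L * sqrt (real n) * c3"
    and Delta_def:
      "\<Delta> = min (\<mu> * c1 / (C + \<mu> * c1)) (\<mu> * c2 / (L * C + 2 * L * \<mu> * c1 + \<mu> * c2))"
    and R: "\<lceil>ln \<Delta> / ln \<delta>\<rceil> + phi (ln \<Delta> / ln \<delta>) \<le> int R"
  shows "real_spectral_radius (G_alpha n \<delta> R L \<mu> a) < 1"
proof -
  define c where "c j = (if j = 0 then c1 else if j = 1 then c2 else c3)" for j :: nat
  have c_simps: "c 0 = c1" "c 1 = c2" "c 2 = c3" by (simp_all add: c_def)
  have L: "0 < L" using mu by simp
  have s: "0 < sqrt (real n)" using n by simp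
  have "0 < L * (L * c1 + c2) / (\<mu>^2 * sqrt (real n))"
    using L c mu s by (intro divide_pos_pos mult_pos_pos add_pos_pos) auto
  then have c3_pos: "0 < c3" using c3 by simp
  have C: "0 < C" unfolding C_def using L c c3_pos s by (intro add_pos_pos mult_pos_pos) auto
  have pos: "0 < C + \<mu> * c1" "0 < \<mu> * c1" "0 < \<mu> * c2" "0 < L * C" "0 < 2 * L * \<mu> * c1"
    using C c mu L by (simp_all add: add_pos_pos)
  have "0 < \<Delta>" unfolding Delta_def using pos by (simp add: add_pos_pos)
  moreover have "\<mu> * c1 / (C + \<mu> * c1) < 1" using pos C by simp
  then have "\<Delta> < 1" unfolding Delta_def by simp
  ultimately have small: "\<delta> ^ R < \<Delta>"
    by (rule power_less_of_phi_bound[OF \<delta> _ _ R])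
  have small1: "\<delta> ^ R * (C + \<mu> * c1) < \<mu> * c1"
    using small pos by (simp add: Delta_def pos_less_divide_eq)
  have small2: "\<delta> ^ R * (L * C + 2 * L * \<mu> * c1 + \<mu> * c2) < \<mu> * c2"
    using small pos by (simp add: Delta_def pos_less_divide_eq)
  have aC: "a * C \<le> C / \<mu>" using mult_right_mono[OF a(2), of C] C by simp
  have dR: "0 < \<delta> ^ R" using \<delta> by simp
  have "\<delta> ^ R * (c1 + a * C) \<le> \<delta> ^ R * (c1 + C / \<mu>)"
    using aC dR by simp
  also have "\<dots> < c1"
    using small1 mu by (simp add: field_simps)
  finally have row0: "\<delta> ^ R * (c1 + a * C) < c1" .
  have "\<delta> ^ R * (c2 + L * (2 * c1 + a * C)) \<le> \<delta> ^ R * (c2 + L * (2 * c1 + C / \<mu>))"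
    using aC dR L by simp
  also have "\<dots> < c2"
    using small2 mu by (simp add: field_simps)
  finally have row1: "\<delta> ^ R * (c2 + L * (2 * c1 + a * C)) < c2" .
  have "a / sqrt (real n) * (L * c1 + c2) \<le> (1 / \<mu>) / sqrt (real n) * (L * c1 + c2)"
    using a s L c by (intro mult_right_mono divide_right_mono) auto
  also have "\<dots> < \<mu> / L * c3"
    using c3 mu L s by (simp add: field_simps power2_eq_square)
  finally have row2: "(1 - \<mu> / L) * c3 + a / sqrt (real n) * (L * c1 + c2) < c3"
    by (simp add: left_diff_distrib)
  show ?thesis
  proof (rule real_spectral_radius_less_1[OF G_alpha_carrier])
    fix i assume i: "i < (3::nat)"
    show "0 < c i" using c c3_pos by (simp add: c_def)
    from less_3_cases[OF i] show "(\<Sum>j<3. G_alpha n \<delta> R L \<mu> a $$ (i, j) * c j) < c i"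
    proof (elim disjE)
      assume "i = 0"
      then show ?thesis using row0 unfolding G_alpha_row_sum \<open>i = 0\<close> c_simps C_def by (simp add: add_ac)
    next
      assume "i = 1"
      then show ?thesis using row1 unfolding \<open>i = 1\<close> G_alpha_row_sum c_simps C_def by (simp add: add_ac)
    next
      assume "i = 2"
      then show ?thesis using row2 unfolding \<open>i = 2\<close> G_alpha_row_sum c_simps by simp
    qed
  qed (use G_alpha_nonneg a L mu \<delta> in auto)
qed

section \<open>Geometric convergence\<close>

text \<open>
  Only the finitely many initial step sizes can exceed \<open>b\<close>, so the supremum is over a bounded set.
\<close>
lemma alpha_max_upper:
  fixes \<alpha> :: "nat \<Rightarrow> 'n::finite \<Rightarrow> real"
  assumes "\<And>k i. 1 \<le> k \<Longrightarrow> \<alpha> k i \<le> b"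
  shows "\<alpha> k i \<le> alpha_max \<alpha>"
proof -
  have "\<alpha> k i \<le> max b (Max (range (\<alpha> 0)))" for k i
    using assms[of k i] by (cases "k = 0") (auto simp: le_max_iff_disj)
  then have "bdd_above (range (\<lambda>(k, i). \<alpha> k i))"
    by (intro bdd_aboveI[of _ "max b (Max (range (\<alpha> 0)))"]) auto
  then show ?thesis
    unfolding alpha_max_def by (intro cSup_upper) (auto intro: range_eqI[of _ _ "(k, i)"])
qed

theorem theorem1:
  fixes E :: "('n::finite \<times> 'n) set"
    and W :: "real^'n^'n"
    and f :: "'n \<Rightarrow> real^'p \<Rightarrow> real"
    and g :: "'n \<Rightarrow> real^'p \<Rightarrow> real^'p"
    and x y :: "nat \<Rightarrow> real^'p^'n"
    and \<alpha> :: "nat \<Rightarrow> 'n \<Rightarrow> real"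
    and L \<mu> \<delta> c1 c2 c3 C \<Delta> \<rho> :: real
    and R :: nat
  assumes gradient: "\<And>i u. GDERIV (f i) u :> g i u"
    and L_pos: "0 < L"
    and smooth: "\<And>i u v. norm (g i u - g i v) \<le> L * norm (u - v)"
    and mu_pos: "0 < \<mu>"
    and strongly_convex:
      "\<And>i u v. f i u \<ge> f i v + g i v \<bullet> (u - v) + \<mu> / 2 * (norm (u - v))^2"
    and graph: "connected_graph E"
    and weights: "doubly_stochastic W"
    and sparsity: "\<And>i j. j \<notin> neighbours E i \<union> {i} \<Longrightarrow> W $ i $ j = 0"
    and delta_def: "\<delta> = spectral_norm (W - averaging_matrix)"
    and delta: "0 < \<delta>" "\<delta> < 1"
    and R_pos: "0 < R"
    and run: "dgm_bb_c W g R x y \<alpha>"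
    and avg_step: "\<And>k. (1 / real CARD('n)) * (\<Sum>i\<in>UNIV. \<alpha> k i) \<le> 2 / L - \<mu> / L^2"
    and max_step: "1 / L \<le> alpha_max \<alpha>" "alpha_max \<alpha> \<le> 1 / \<mu>"
    and c1: "0 < c1"
    and c2: "0 < c2"
    and c3: "L * (L * c1 + c2) / (\<mu>^2 * sqrt (real CARD('n))) < c3"
    and C_def: "C = L * c1 + c2 + L * sqrt (real CARD('n)) * c3"
    and Delta_def:
      "\<Delta> = min (\<mu> * c1 / (C + \<mu> * c1)) (\<mu> * c2 / (L * C + 2 * L * \<mu> * c1 + \<mu> * c2))"
    and R_bound: "\<lceil>ln \<Delta> / ln \<delta>\<rceil> + phi (ln \<Delta> / ln \<delta>) \<le> int R"
    and rho_def:
      "\<rho> = real_spectral_radius (G_alpha CARD('n) \<delta> R L \<mu> (alpha_max \<alpha>))"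
  shows "\<exists>xopt. (\<forall>u. is_arg_min (avg_objective f) (\<lambda>_. True) u \<longleftrightarrow> u = xopt) \<and>
           x \<longlonglongrightarrow> (\<chi> i. xopt) \<and>
           \<rho> < 1 \<and>
           (\<forall>\<xi>>0. \<exists>M>0. \<forall>k. norm (x k - (\<chi> i. xopt)) \<le> M * (\<rho> + \<xi>)^k)"
proof -
  let ?const = "\<lambda>u. (\<chi> i. u) :: real^'p^'n"
  let ?n = "real CARD('n)"
  define A where "A = alpha_max \<alpha>"
  define G where "G = G_alpha CARD('n) \<delta> R L \<mu> A"
  have qb: "quadratic_bounds \<mu> L (f i) (g i)" for i
    unfolding quadratic_bounds_def
    using strongly_convex descent_lemma[OF gradient smooth] by auto
  then have mu_L: "\<mu> \<le> L" by (rule strong_convexity_le_smoothness)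
  have mean_gradient: "(1 / ?n) *\<^sub>R (\<Sum>i\<in>UNIV. g i u) = row_mean (stacked_gradient g (?const u))" for u
    by (simp add: row_mean_def stacked_gradient_def)
  have qb_avg: "quadratic_bounds \<mu> L (avg_objective f) (\<lambda>u. row_mean (stacked_gradient g (?const u)))"
    using quadratic_bounds_avg_objective[of \<mu> L f g, OF qb] unfolding mean_gradient .
  obtain w where zero: "row_mean (stacked_gradient g (?const w)) = 0"
    using gradient_zero_exists[OF qb_avg mu_pos] by auto

  have bb: "1 / L \<le> \<alpha> k i" "\<alpha> k i \<le> 1 / \<mu>" if "1 \<le> k" for k i
  proof -
    have "bb_step (x k $ i - x (k - 1) $ i) (g i (x k $ i) - g i (x (k - 1) $ i)) (\<alpha> k i)"
      using run that unfolding dgm_bb_c_def by blast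
    from bb_step_bounds[OF qb mu_pos mu_L this] show "1 / L \<le> \<alpha> k i" "\<alpha> k i \<le> 1 / \<mu>" .
  qed
  have upper: "\<alpha> k i \<le> A" for k i
    unfolding A_def using bb(2) by (rule alpha_max_upper)
  have inv_L: "0 \<le> 1 / L" using L_pos by simp
  have A: "0 \<le> A" "A \<le> 1 / \<mu>"
    using max_step order_trans[OF inv_L max_step(1)] by (simp_all add: A_def)
  have avg_lower: "1 / L \<le> (1 / ?n) * (\<Sum>i\<in>UNIV. \<alpha> k i)" if "1 \<le> k" for k
  proof -
    have "(\<Sum>i\<in>(UNIV::'n set). 1 / L) \<le> (\<Sum>i\<in>UNIV. \<alpha> k i)"
      using bb(1)[OF that] by (rule sum_mono)
    then have "(1 / ?n) * (\<Sum>i\<in>(UNIV::'n set). 1 / L) \<le> (1 / ?n) * (\<Sum>i\<in>UNIV. \<alpha> k i)"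
      by (rule mult_left_mono) simp
    then show ?thesis by simp
  qed

  (* The errors are counted from iteration one, since the initial step sizes are arbitrary and in
     particular may be smaller than 1 / L. *)
  define v where "v k i = (if i = 0 then norm (disagreement (x (Suc k)))
      else if i = 1 then norm (disagreement (y (Suc k)))
      else norm (row_mean (x (Suc k)) - w))" for k i :: nat
  have v_simps: "v k 0 = norm (disagreement (x (Suc k)))" "v k 1 = norm (disagreement (y (Suc k)))"
    "v k 2 = norm (row_mean (x (Suc k)) - w)" for k
    by (simp_all add: v_def)
  have step: "v (Suc k) i \<le> (\<Sum>j<3. G $$ (i, j) * v k j)" if i: "i < 3" for k i
  proof -
    have steps: "0 \<le> \<alpha> (Suc k) i" for i
      using order_trans[OF inv_L bb(1)[of "Suc k" i]] by simp
    have rec: "x (Suc (Suc k)) = matrix_power W R ** (x (Suc k) - diag_matrix (\<alpha> (Suc k)) ** y (Suc k))"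
      "y (Suc (Suc k)) = matrix_power W R **
        (y (Suc k) + stacked_gradient g (x (Suc (Suc k))) - stacked_gradient g (x (Suc k)))"
      using run unfolding dgm_bb_c_def by blast+
    have lower: "1 / L \<le> (1 / ?n) * (\<Sum>i\<in>UNIV. \<alpha> (Suc k) i)"
      by (rule avg_lower) simp
    note errors = dgm_step_errors[OF weights delta_def less_imp_le[OF delta(2)] smooth qb_avg mu_pos mu_L
        zero gradient_tracking[OF weights run] steps upper lower avg_step rec]
    from less_3_cases[OF i] show ?thesis
    proof (elim disjE)
      assume "i = 0"
      show ?thesis unfolding \<open>i = 0\<close> G_def G_alpha_row_sum v_simps by (rule errors(1))
    next
      assume "i = 1"
      show ?thesis unfolding \<open>i = 1\<close> G_def G_alpha_row_sum v_simps by (rule errors(2))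
    next
      assume "i = 2"
      show ?thesis unfolding \<open>i = 2\<close> G_def G_alpha_row_sum v_simps by (rule errors(3))
    qed
  qed
  have G_nonneg: "0 \<le> G $$ (i, j)" if "i < 3" "j < 3" for i j
    unfolding G_def using G_alpha_nonneg delta A L_pos mu_L that by simp
  have G_carrier: "G \<in> carrier_mat 3 3" unfolding G_def by (rule G_alpha_carrier)
  have rho: "\<rho> = real_spectral_radius G" by (simp add: rho_def G_def A_def)
  have rho_less: "\<rho> < 1"
    unfolding rho G_def
    by (rule G_alpha_spectral_radius_less_1[OF mu_pos mu_L delta _ A c1 c2 c3 C_def Delta_def R_bound]) simp
  have rho_nonneg: "0 \<le> \<rho>"
    unfolding rho by (rule real_spectral_radius_nonneg[OF G_carrier]) simp

  have rate: "\<exists>M>0. \<forall>k. norm (x k - ?const w) \<le> M * (\<rho> + \<xi>)^k" if "0 < \<xi>" for \<xi>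
  proof -
    define r where "r = \<rho> + \<xi>"
    have r: "0 < r" "real_spectral_radius G < r"
      using that rho_nonneg by (simp_all add: r_def rho)
    have "\<exists>M. \<forall>k. \<forall>i<3. v k i \<le> M * r ^ k"
      by (rule linear_recursion_geometric[OF G_carrier]) (use G_nonneg step r(2) in auto)
    then obtain M where M: "\<And>k i. i < 3 \<Longrightarrow> v k i \<le> M * r ^ k"
      by blast
    have M_nonneg: "0 \<le> M"
      using M[of 0 0] by (simp add: v_def order_trans[OF norm_ge_zero])
    (* The first term covers iteration zero, the second pays for the index shift,
       the last makes N positive. *)
    define N where "N = norm (x 0 - ?const w) + (1 + sqrt ?n) * M / r + 1"
    have "norm (x k - ?const w) \<le> N * r ^ k" for k
    proof (cases k)
      case 0
      then show ?thesis using M_nonneg r by (simp add: N_def)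
    next
      case (Suc m)
      have "norm (x k - ?const w) \<le> v m 0 + sqrt ?n * v m 2"
        unfolding v_simps Suc by (rule norm_le_disagreement_row_mean)
      also have "\<dots> \<le> M * r ^ m + sqrt ?n * (M * r ^ m)"
        using M by (intro add_mono mult_left_mono) auto
      also have "\<dots> = ((1 + sqrt ?n) * M / r) * r ^ k"
        using r Suc by (simp add: field_simps)
      also have "\<dots> \<le> N * r ^ k"
        using r by (intro mult_right_mono) (auto simp: N_def)
      finally show ?thesis .
    qed
    moreover have "0 < N"
      unfolding N_def using M_nonneg r by (intro add_nonneg_pos add_nonneg_nonneg) auto
    ultimately show ?thesis unfolding r_def by blast
  qed

  have "x \<longlonglongrightarrow> ?const w"
  proof -
    define r where "r = \<rho> + (1 - \<rho>) / 2"
    have r: "0 \<le> r" "r < 1" using rho_less rho_nonneg by (simp_all add: r_def field_simps)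
    obtain M where M: "\<And>k. norm (x k - ?const w) \<le> M * r ^ k"
      using rate[of "(1 - \<rho>) / 2"] rho_less by (auto simp: r_def)
    have "(\<lambda>k. M * r ^ k) \<longlonglongrightarrow> M * 0"
      using r by (intro tendsto_mult tendsto_const LIMSEQ_realpow_zero)
    then have "(\<lambda>k. M * r ^ k) \<longlonglongrightarrow> 0" by simp
    then have "(\<lambda>k. x k - ?const w) \<longlonglongrightarrow> 0"
      by (rule Lim_null_comparison[rotated]) (simp add: M)
    then show ?thesis by (simp add: Lim_null[of x])
  qed
  moreover have "\<forall>u. is_arg_min (avg_objective f) (\<lambda>_. True) u \<longleftrightarrow> u = w"
    using minimizer_iff_gradient_zero[OF qb_avg mu_pos zero] by blast
  ultimately show ?thesis using rho_less rate by blast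
qed

end
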